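(* Let $m\in\mathbb{Z}$, let $f$ be a density function and $P$ a payoff function satisfying the standing assumptions (S) of the context, and let $\alpha\in\delta_V$ be such that $P_\alpha$ and $f_\alpha$ satisfy assumptions (A) and (B) of the context. For $f_\alpha$, write the constants in (A)(iii) as $a+\alpha$ (lower half-plane) and $b-\alpha$ (upper half-plane), with orders $\gamma^-$ and $\gamma^+$; that is, $-a$ and $b$ are the imaginary parts of the nearest singularities of $\hat f$. Let $\Gamma(s,y)=\int_y^\infty t^{s-1}e^{-t}\,dt$, $\varepsilon_D=\frac1\pi|\operatorname{Im}[\hat f(2^m\pi+\mathrm{i}\alpha)]|$, $\varepsilon_V=\frac1\pi|\operatorname{Im}[\hat P(2^m\pi-\mathrm{i}\alpha)]|$, and let $\mu\in\mathbb{R}$. Then, with $C_+,C_->0$ the constants of the density-coefficient bound recalled in the context, the following hold. For $U:=u/2^m>\max(0,1+\mu)$, up to $O(U^{-2})$, $$\begin{aligned}\bar T^+(u)\le{}& C_+e^{\alpha\mu}\,\frac{\|P_\alpha\|_{L^\infty([U,\infty))}+\varepsilon_VU^{-1}}{(b-\alpha)^{\gamma^+}}\,\Gamma\big(\gamma^+,(b-\alpha)(U-\mu)\big)+\varepsilon_D\|P_\alpha\|_{L^1([U,\infty))}(U-\mu)^{-1}\\&+\varepsilon_D\varepsilon_V\,\mu^{-1}\log\left(\frac{U}{U-\mu}\right)+2^{1-m}\sum_{n=1}^NG_+(y_n^* )\mathbf 1_{\{U<y_n^*\}},\end{aligned}$$ where $y_1^*,\dots,y_N^*$ are the local maxima in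 $(0,\infty)\cap(1+\mu,\infty)$ of $$G_+(y)=\left(C_+e^{\alpha\mu}(y-\mu)^{\gamma^+-1}e^{-(b-\alpha)(y-\mu)}+\varepsilon_D(y-\mu)^{-1}\right)\left(|P_\alpha(y)|+\varepsilon_V|y|^{-1}\right).$$ Analogously, for $L:=l/2^m<\min(0,\mu-1)$, up to $O(L^{-2})$, $$\begin{aligned}\bar T^-(l)\le{}& C_-e^{\alpha\mu}\,\frac{\|P_\alpha\|_{L^\infty((-\infty,L])}+\varepsilon_V|L|^{-1}}{(a+\alpha)^{\gamma^-}}\,\Gamma\big(\gamma^-,(a+\alpha)|L-\mu|\big)+\varepsilon_D\|P_\alpha\|_{L^1((-\infty,L])}|L-\mu|^{-1}\\&+\varepsilon_D\varepsilon_V\,\mu^{-1}\log\left(\frac{L-\mu}{L}\right)+2^{1-m}\sum_{n=1}^NG_-(y_n^* )\mathbf 1_{\{L>y_n^*\}},\end{aligned}$$ where $y_1^*,\dots,y_N^*$ are now the local maxima in $(-\infty,0)\cap(-\infty,\mu-1)$ of $$G_-(y)=\left(C_-e^{\alpha\mu}|y-\mu|^{\gamma^--1}e^{-(a+\alpha)|y-\mu|}+\varepsilon_D|y-\mu|^{-1}\right)\left(|P_\alpha(y)|+\varepsilon_V|y|^{-1}\right).$$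
   Context: Fourier transform: $\hat h(z)=\int_{\mathbb{R}}h(y)e^{-\mathrm{i}zy}\,dy$. Damped functions: $P_\alpha(y)=e^{-\alpha y}P(y)$, $f_\alpha(y)=e^{\alpha y}f(y)$; $\delta_P=\{\alpha\in\mathbb{R}:P_\alpha\in L^1(\mathbb{R})\}$, $\delta_f=\{\alpha\in\mathbb{R}:f_\alpha\in L^1(\mathbb{R})\}$, $\delta_V=\delta_P\cap\delta_f$. With $\phi_{m,k}(y)=2^{m/2}\operatorname{sinc}(2^my-k)$, $\operatorname{sinc}(x)=\frac{\sin\pi x}{\pi x}$, put $D^\alpha_{m,k}=\int f_\alpha\phi_{m,k}\,dy$, $V^\alpha_{m,k}=\int P_\alpha\phi_{m,k}\,dy$, and for integers $u,l$ $$\bar T^+(u)=\sum_{k>u}|D^\alpha_{m,k}V^\alpha_{m,k}|,\qquad \bar T^-(l)=\sum_{k<l}|D^\alpha_{m,k}V^\alpha_{m,k}|.$$ Density-coefficient bound: the number $\mu$ plays the role of a centering parameter for $f$ (that is, $f(y)=f_0(y-\mu)$), and $C_\pm>0$ are constants such that, with $y_{k,\mu}=k/2^m-\mu$ and up to $O(y_{k,\mu}^{-2})$, $|D^\alpha_{m,k}|\le2^{-m/2}\big(C_+e^{\alpha\mu}y_{k,\mu}^{\gamma^+-1}e^{-(b-\alpha)y_{k,\mu}}+\varepsilon_Dy_{k,\mu}^{-1}\big)$ for $y_{k,\mu}>1$ and $|D^\alpha_{m,k}|\le2^{-m/2}\big(C_-e^{\alpha\mu}|y_{k,\mu}|^{\gamma^--1}e^{-(a+\alpha)|y_{k,\mu}|}+\varepsilon_D|y_{k,\mu}|^{-1}\big)$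 for $y_{k,\mu}<-1$. If a grid point $k/2^m$ is a jump point of $P$, the larger of the two one-sided limits of the payoff is used there. (S) Standing assumptions: $f$ and $P$ are piecewise $C^1$ (finite partition of $\mathbb{R}$ into intervals) with finitely many critical points; $P$ is defined on all of $\mathbb{R}$ and may jump, with uniformly bounded jump sizes; $\delta_V\ne\varnothing$, $\alpha\in\delta_V$, and $f_\alpha,P_\alpha\in L^2(\mathbb{R})$. (B) for $h$: with $r=2^m\pi$ and some integer $M\ge0$, $\hat h\in C^{M+1}(\{|u|>r\})$, $\hat h^{(j)}(u)\to0$ as $|u|\to\infty$ for $0\le j\le M$, and $\hat h^{(M+1)}\in L^1(\{|u|>r\})$. (A) for $h$: $h\in L^1(\mathbb{R})$ is real-valued and piecewise $C^1$, and $\hat h$ can be extended to $\mathbb{C}\setminus(\gamma_{u_1}\cup\dots\cup\gamma_{u_{N'}})$ as $\hat h=Z+H$ with $H$ entire and $Z$ having algebraic or logarithmic branch points $u_1,\dots,u_{N'}\in\mathbb{C}\setminus\mathbb{R}$ of orders $\rho_n\in\mathbb{C}\setminus\{0\}$, and: (i) $|\hat h(u)|\le C(1+|u|^q)$ for some $C,q>0$; (ii) for some $\theta\in(0,\frac\pi2)$, $\sup_{u\in\gamma(R,\theta)}(|\hat h(u)|+|\hat h(-u)|)$ and $\sup_{u\in\gamma(-R,\pi-\theta)}(|\hat h(u)|+|\hat h(-u)|)$ tend to $0$ as $R\to+\infty$; (iii) there are $a_h,b_h,\gamma^+,\gamma^->0$ such that $\operatorname{Im}u_n>0$ implies $\operatorname{Im}u_n\ge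 b_h$, with $\operatorname{Re}\rho_n\le\gamma^+$ if $\operatorname{Im}u_n=b_h$; and $\operatorname{Im}u_n<0$ implies $\operatorname{Im}u_n\le-a_h$, with $\operatorname{Re}\rho_n\le\gamma^-$ if $\operatorname{Im}u_n=-a_h$. Here $\operatorname{sgn}(t)=1$ for $t\ge0$ and $-1$ for $t<0$; $\gamma(u_0,\theta)=\{u_0+\operatorname{sgn}(\operatorname{Im}u_0)e^{\mathrm{i}\theta}t:t>0\}$ and $\gamma_{u_0}=\gamma(u_0,\frac\pi2)$ (branch cut). On the plane slit along the cut a branch of $\log(u-u_0)$ is fixed, so that $(u-u_0)^{-\rho}$ is well defined. $Z$ has algebraic branch points $u_n$ of orders $\rho_n$ if $Z(u)=g(u)\prod_n(u-u_n)^{-\rho_n}$ with $g$ entire. If close to some $u_n$ one has instead $Z(u)=(u-u_n)^{-\rho}\log(u-u_n)g(u)$ with $-\rho\in\mathbb{N}$ and $g$ analytic there, then $u_n$ is a logarithmic branch point of order $\rho$. *)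

theory Defs
  imports "HOL-Analysis.Analysis" "HOL-Probability.Essential_Supremum"
begin

section \<open>Fourier transform and damping\<close>

definition fourier :: "(real \<Rightarrow> real) \<Rightarrow> complex \<Rightarrow> complex" where
  "fourier h z = (LBINT y. of_real (h y) * exp (- \<i> * z * of_real y))"

definition damp_payoff :: "real \<Rightarrow> (real \<Rightarrow> real) \<Rightarrow> real \<Rightarrow> real" where
  "damp_payoff \<alpha> P y = exp (- \<alpha> * y) * P y"

definition damp_density :: "real \<Rightarrow> (real \<Rightarrow> real) \<Rightarrow> real \<Rightarrow> real" where
  "damp_density \<alpha> f y = exp (\<alpha> * y) * f y"

definition delta_P :: "(real \<Rightarrow> real) \<Rightarrow> real set" where
  "delta_P P = {\<alpha>. integrable lborel (damp_payoff \<alpha> P)}"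

definition delta_f :: "(real \<Rightarrow> real) \<Rightarrow> real set" where
  "delta_f f = {\<alpha>. integrable lborel (damp_density \<alpha> f)}"

definition delta_V :: "(real \<Rightarrow> real) \<Rightarrow> (real \<Rightarrow> real) \<Rightarrow> real set" where
  "delta_V f P = delta_P P \<inter> delta_f f"


section \<open>Sinc basis, coefficients and truncation tails\<close>

definition nsinc :: "real \<Rightarrow> real" where
  "nsinc x = (if x = 0 then 1 else sin (pi * x) / (pi * x))"

definition phi :: "int \<Rightarrow> int \<Rightarrow> real \<Rightarrow> real" where
  "phi m k y = 2 powr (of_int m / 2) * nsinc (2 powi m * y - of_int k)"

definition D_coeff :: "int \<Rightarrow> real \<Rightarrow> (real \<Rightarrow> real) \<Rightarrow> int \<Rightarrow> real" where
  "D_coeff m \<alpha> f k = (LBINT y. damp_density \<alpha> f y * phi m k y)"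

definition V_coeff :: "int \<Rightarrow> real \<Rightarrow> (real \<Rightarrow> real) \<Rightarrow> int \<Rightarrow> real" where
  "V_coeff m \<alpha> P k = (LBINT y. damp_payoff \<alpha> P y * phi m k y)"

text \<open>The tails are sums in \<open>[0, \<infinity>]\<close>, so that a finite upper bound includes convergence.\<close>

definition T_plus :: "int \<Rightarrow> real \<Rightarrow> (real \<Rightarrow> real) \<Rightarrow> (real \<Rightarrow> real) \<Rightarrow> int \<Rightarrow> ennreal" where
  "T_plus m \<alpha> f P u = (\<Sum>\<^sub>\<infinity>k\<in>{u<..}. ennreal \<bar>D_coeff m \<alpha> f k * V_coeff m \<alpha> P k\<bar>)"

definition T_minus :: "int \<Rightarrow> real \<Rightarrow> (real \<Rightarrow> real) \<Rightarrow> (real \<Rightarrow> real) \<Rightarrow> int \<Rightarrow> ennreal" where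
  "T_minus m \<alpha> f P l = (\<Sum>\<^sub>\<infinity>k\<in>{..<l}. ennreal \<bar>D_coeff m \<alpha> f k * V_coeff m \<alpha> P k\<bar>)"

definition grid :: "int \<Rightarrow> int \<Rightarrow> real" where
  "grid m k = of_int k / 2 powi m"

definition eps_D :: "int \<Rightarrow> real \<Rightarrow> (real \<Rightarrow> real) \<Rightarrow> real" where
  "eps_D m \<alpha> f = \<bar>Im (fourier f (of_real (2 powi m * pi) + \<i> * of_real \<alpha>))\<bar> / pi"

definition eps_V :: "int \<Rightarrow> real \<Rightarrow> (real \<Rightarrow> real) \<Rightarrow> real" where
  "eps_V m \<alpha> P = \<bar>Im (fourier P (of_real (2 powi m * pi) - \<i> * of_real \<alpha>))\<bar> / pi"


section \<open>Standing assumptions (S)\<close>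

definition density_function :: "(real \<Rightarrow> real) \<Rightarrow> bool" where
  "density_function f \<longleftrightarrow>
     (\<forall>y. 0 \<le> f y) \<and> integrable lborel f \<and> (LBINT y. f y) = 1"

text \<open>
  Unlike \<^const>\<open>piecewise_C1_differentiable_on\<close>, no continuity is required at the
  finitely many partition points: jumps are allowed.
\<close>

definition piecewise_C1 :: "(real \<Rightarrow> real) \<Rightarrow> bool" where
  "piecewise_C1 h \<longleftrightarrow> (\<exists>S. finite S \<and> h C1_differentiable_on (- S))"

text \<open>
  Payoffs such as \<open>max 0 (K - exp y)\<close> are constant on a half-line, where every point has
  derivative zero. A flat stretch is therefore counted as one critical point: the critical
  set is required to have finitely many connected components. This holds in particular
  whenever the critical set is finite.
\<close>

definition finitely_many_critical :: "(real \<Rightarrow> real) \<Rightarrow> bool" where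
  "finitely_many_critical h \<longleftrightarrow> finite (components {x. (h has_real_derivative 0) (at x)})"

definition bounded_jumps :: "(real \<Rightarrow> real) \<Rightarrow> bool" where
  "bounded_jumps P \<longleftrightarrow>
     (\<exists>J. \<forall>x. \<exists>l r. (P \<longlongrightarrow> l) (at_left x) \<and> (P \<longlongrightarrow> r) (at_right x) \<and> \<bar>r - l\<bar> \<le> J)"

definition assumption_S :: "(real \<Rightarrow> real) \<Rightarrow> (real \<Rightarrow> real) \<Rightarrow> real \<Rightarrow> bool" where
  "assumption_S f P \<alpha> \<longleftrightarrow>
     piecewise_C1 f \<and> finitely_many_critical f \<and>
     piecewise_C1 P \<and> finitely_many_critical P \<and> bounded_jumps P \<and>
     delta_V f P \<noteq> {} \<and> \<alpha> \<in> delta_V f P \<and>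
     integrable lborel (\<lambda>y. (damp_density \<alpha> f y)\<^sup>2) \<and>
     integrable lborel (\<lambda>y. (damp_payoff \<alpha> P y)\<^sup>2)"


section \<open>Assumption (B)\<close>

text \<open>\<open>d j\<close> is the \<open>j\<close>-th derivative of the Fourier transform on \<open>\<bar>u\<bar> > 2\<^sup>m \<pi>\<close>.\<close>

definition assumption_B :: "int \<Rightarrow> (real \<Rightarrow> real) \<Rightarrow> bool" where
  "assumption_B m h \<longleftrightarrow>
     (\<exists>(M::nat) (d :: nat \<Rightarrow> real \<Rightarrow> complex).
        let A = {u::real. \<bar>u\<bar> > 2 powi m * pi} in
        (\<forall>u\<in>A. d 0 u = fourier h (of_real u)) \<and>
        (\<forall>j\<le>M. \<forall>u\<in>A. (d j has_vector_derivative d (Suc j) u) (at u)) \<and>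
        continuous_on A (d (Suc M)) \<and>
        (\<forall>j\<le>M. (d j \<longlongrightarrow> 0) at_infinity) \<and>
        set_integrable lborel A (d (Suc M)))"


section \<open>Branch points and assumption (A)\<close>

definition sgn_cut :: "real \<Rightarrow> real" where
  "sgn_cut t = (if t \<ge> 0 then 1 else - 1)"

definition ray :: "complex \<Rightarrow> real \<Rightarrow> complex set" where
  "ray u0 \<theta> = {u0 + of_real (sgn_cut (Im u0)) * cis \<theta> * of_real t | t::real. t > 0}"

definition branch_cut :: "complex \<Rightarrow> complex set" where
  "branch_cut u0 = ray u0 (pi / 2)"

text \<open>
  The rays are open at their initial point, where a branch of the logarithm cannot be
  defined; the slit plane therefore omits the branch points themselves as well.
\<close>

definition slit_plane :: "complex set \<Rightarrow> complex set" where
  "slit_plane B = - (\<Union>b\<in>B. insert b (branch_cut b))"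

definition log_branch :: "complex \<Rightarrow> (complex \<Rightarrow> complex) \<Rightarrow> bool" where
  "log_branch u0 Lg \<longleftrightarrow>
     Lg holomorphic_on slit_plane {u0} \<and> (\<forall>u\<in>slit_plane {u0}. exp (Lg u) = u - u0)"

text \<open>
  \<open>Lg b\<close> is the chosen branch of \<open>log (u - b)\<close>, so \<open>exp (- \<rho> b * Lg b u)\<close> is
  \<open>(u - b)\<^bsup>-\<rho>\<^esup>\<close>. The set of branch points is split into an algebraic part \<open>B\<^sub>a\<close> and a
  logarithmic part \<open>B\<^sub>l\<close>. If \<open>B\<^sub>l = {}\<close>, then \<open>slit_plane B\<^sub>l = UNIV\<close> and \<open>g\<close> is entire.
  Otherwise \<open>g\<close> carries the logarithmic singularities, which are described locally.
\<close>

definition has_branch_points ::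
  "(complex \<Rightarrow> complex) \<Rightarrow> complex set \<Rightarrow> (complex \<Rightarrow> complex) \<Rightarrow> (complex \<Rightarrow> complex \<Rightarrow> complex) \<Rightarrow> bool"
where
  "has_branch_points Z B \<rho> Lg \<longleftrightarrow>
     (\<exists>B\<^sub>a B\<^sub>l g. B = B\<^sub>a \<union> B\<^sub>l \<and> B\<^sub>a \<inter> B\<^sub>l = {} \<and>
        g holomorphic_on slit_plane B\<^sub>l \<and>
        (\<forall>u\<in>slit_plane B. Z u = g u * (\<Prod>b\<in>B\<^sub>a. exp (- \<rho> b * Lg b u))) \<and>
        (\<forall>b\<in>B\<^sub>l. - \<rho> b \<in> \<nat> \<and>
           (\<exists>e>0. \<exists>G. G holomorphic_on ball b e \<and>
              (\<forall>u\<in>ball b e \<inter> slit_plane B. Z u = exp (- \<rho> b * Lg b u) * Lg b u * G u))))"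

text \<open>
  \<open>F = Z + H\<close> is the extension of the Fourier transform of \<open>h\<close>. The polynomial bound is
  required for large \<open>\<bar>u\<bar>\<close> in the slit plane: at a branch point with \<open>Re \<rho> > 0\<close> the
  extension is unbounded, so no such bound can hold near it.
\<close>

definition assumption_A ::
  "(real \<Rightarrow> real) \<Rightarrow> real \<Rightarrow> real \<Rightarrow> real \<Rightarrow> real \<Rightarrow> bool"
where
  "assumption_A h a\<^sub>h b\<^sub>h \<gamma>\<^sub>p \<gamma>\<^sub>m \<longleftrightarrow>
     integrable lborel h \<and> piecewise_C1 h \<and>
     a\<^sub>h > 0 \<and> b\<^sub>h > 0 \<and> \<gamma>\<^sub>p > 0 \<and> \<gamma>\<^sub>m > 0 \<and>
     (\<exists>B \<rho> Lg Z H F.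
        finite B \<and>
        (\<forall>b\<in>B. Im b \<noteq> 0 \<and> \<rho> b \<noteq> 0 \<and> log_branch b (Lg b)) \<and>
        H holomorphic_on UNIV \<and> has_branch_points Z B \<rho> Lg \<and>
        (\<forall>u\<in>slit_plane B. F u = Z u + H u) \<and>
        (\<forall>x::real. F (of_real x) = fourier h (of_real x)) \<and>
        (\<exists>C>0. \<exists>q>0. \<exists>R. \<forall>u\<in>slit_plane B. norm u \<ge> R \<longrightarrow> norm (F u) \<le> C * (1 + norm u powr q)) \<and>
        (\<exists>\<theta>. 0 < \<theta> \<and> \<theta> < pi / 2 \<and>
           ((\<lambda>R. SUP u\<in>ray (of_real R) \<theta>. ennreal (norm (F u) + norm (F (- u)))) \<longlongrightarrow> 0) at_top \<and>
           ((\<lambda>R. SUP u\<in>ray (of_real (- R)) (pi - \<theta>). ennreal (norm (F u) + norm (F (- u)))) \<longlongrightarrow> 0) at_top) \<and>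
        (\<forall>b\<in>B. Im b > 0 \<longrightarrow> Im b \<ge> b\<^sub>h \<and> (Im b = b\<^sub>h \<longrightarrow> Re (\<rho> b) \<le> \<gamma>\<^sub>p)) \<and>
        (\<forall>b\<in>B. Im b < 0 \<longrightarrow> Im b \<le> - a\<^sub>h \<and> (Im b = - a\<^sub>h \<longrightarrow> Re (\<rho> b) \<le> \<gamma>\<^sub>m)))"


section \<open>Density-coefficient bound\<close>

definition density_coeff_bound ::
  "int \<Rightarrow> (real \<Rightarrow> real) \<Rightarrow> real \<Rightarrow> real \<Rightarrow> real \<Rightarrow> real \<Rightarrow> real \<Rightarrow> real \<Rightarrow> real \<Rightarrow> real \<Rightarrow> bool"
where
  "density_coeff_bound m f \<alpha> \<mu> a b \<gamma>\<^sub>p \<gamma>\<^sub>m C\<^sub>p C\<^sub>m \<longleftrightarrow>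
     (\<exists>K. \<forall>k. let y = grid m k - \<mu> in
        (y > 1 \<longrightarrow> \<bar>D_coeff m \<alpha> f k\<bar> \<le> 2 powr (- of_int m / 2) *
            (C\<^sub>p * exp (\<alpha> * \<mu>) * y powr (\<gamma>\<^sub>p - 1) * exp (- (b - \<alpha>) * y) + eps_D m \<alpha> f / y)
            + K / y\<^sup>2) \<and>
        (y < - 1 \<longrightarrow> \<bar>D_coeff m \<alpha> f k\<bar> \<le> 2 powr (- of_int m / 2) *
            (C\<^sub>m * exp (\<alpha> * \<mu>) * \<bar>y\<bar> powr (\<gamma>\<^sub>m - 1) * exp (- (a + \<alpha>) * \<bar>y\<bar>) + eps_D m \<alpha> f / \<bar>y\<bar>)
            + K / y\<^sup>2))"


section \<open>Ingredients of the tail bounds\<close>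

definition upper_Gamma :: "real \<Rightarrow> real \<Rightarrow> real" where
  "upper_Gamma s y = (LBINT t:{y..}. t powr (s - 1) * exp (- t))"

definition Linf_norm :: "real set \<Rightarrow> (real \<Rightarrow> real) \<Rightarrow> ennreal" where
  "Linf_norm A h = esssup (restrict_space lborel A) (\<lambda>y. ennreal \<bar>h y\<bar>)"

definition L1_norm :: "real set \<Rightarrow> (real \<Rightarrow> real) \<Rightarrow> ennreal" where
  "L1_norm A h = (\<integral>\<^sup>+y\<in>A. ennreal \<bar>h y\<bar> \<partial>lborel)"

text \<open>
  \<open>\<mu>\<^sup>-\<^sup>1 log (U / (U - \<mu>))\<close> and \<open>\<mu>\<^sup>-\<^sup>1 log ((L - \<mu>) / L)\<close>, extended continuously to
  \<open>\<mu> = 0\<close>. They are the integrals of \<open>1 / (\<bar>y - \<mu>\<bar> * \<bar>y\<bar>)\<close> over \<open>{U..}\<close> and \<open>{..L}\<close>.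
  With the convention \<open>inverse 0 = 0\<close> the bare formula would wrongly vanish at \<open>\<mu> = 0\<close>.
\<close>

definition log_term_plus :: "real \<Rightarrow> real \<Rightarrow> real" where
  "log_term_plus \<mu> U = (if \<mu> = 0 then 1 / U else inverse \<mu> * ln (U / (U - \<mu>)))"

definition log_term_minus :: "real \<Rightarrow> real \<Rightarrow> real" where
  "log_term_minus \<mu> L = (if \<mu> = 0 then 1 / \<bar>L\<bar> else inverse \<mu> * ln ((L - \<mu>) / L))"

text \<open>
  The payoff with the convention that at a grid point where it jumps, the larger of the two
  one-sided limits is used. Integrals and essential suprema do not see this change.
\<close>

definition grid_payoff :: "int \<Rightarrow> (real \<Rightarrow> real) \<Rightarrow> real \<Rightarrow> real" where
  "grid_payoff m P y =
     (if y \<in> range (grid m) \<and> Lim (at_left y) P \<noteq> Lim (at_right y) P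
      then max (Lim (at_left y) P) (Lim (at_right y) P) else P y)"

definition G_plus ::
  "int \<Rightarrow> (real \<Rightarrow> real) \<Rightarrow> (real \<Rightarrow> real) \<Rightarrow> real \<Rightarrow> real \<Rightarrow> real \<Rightarrow> real \<Rightarrow> real \<Rightarrow> real \<Rightarrow> real"
where
  "G_plus m f P \<alpha> \<mu> b \<gamma> C y =
     (C * exp (\<alpha> * \<mu>) * (y - \<mu>) powr (\<gamma> - 1) * exp (- (b - \<alpha>) * (y - \<mu>)) + eps_D m \<alpha> f / (y - \<mu>)) *
     (\<bar>damp_payoff \<alpha> (grid_payoff m P) y\<bar> + eps_V m \<alpha> P / \<bar>y\<bar>)"

definition G_minus ::
  "int \<Rightarrow> (real \<Rightarrow> real) \<Rightarrow> (real \<Rightarrow> real) \<Rightarrow> real \<Rightarrow> real \<Rightarrow> real \<Rightarrow> real \<Rightarrow> real \<Rightarrow> real \<Rightarrow> real"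
where
  "G_minus m f P \<alpha> \<mu> a \<gamma> C y =
     (C * exp (\<alpha> * \<mu>) * \<bar>y - \<mu>\<bar> powr (\<gamma> - 1) * exp (- (a + \<alpha>) * \<bar>y - \<mu>\<bar>) + eps_D m \<alpha> f / \<bar>y - \<mu>\<bar>) *
     (\<bar>damp_payoff \<alpha> (grid_payoff m P) y\<bar> + eps_V m \<alpha> P / \<bar>y\<bar>)"

definition local_maxima :: "(real \<Rightarrow> real) \<Rightarrow> real set \<Rightarrow> real set" where
  "local_maxima G S = {y\<in>S. \<forall>\<^sub>F z in at y within S. G z \<le> G y}"

end

theory Submission
  imports Defs "HOL-Complex_Analysis.Cauchy_Integral_Formula" "HOL-Real_Asymp.Real_Asymp"
begin

text \<open>
  Away from its centre \<open>y\<^sub>k = k / 2\<^sup>m\<close> the function \<open>\<phi>\<^sub>m\<^sub>,\<^sub>k\<close> is, up to sign and scale,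
  \<open>sin (2\<^sup>m \<pi> y) / (y - y\<^sub>k)\<close>. Expanding \<open>1 / (y - y\<^sub>k)\<close> in powers of \<open>1 / y\<^sub>k\<close> shows that the payoff
  coefficient is at most \<open>2\<^bsup>-m/2\<^esup> \<epsilon>\<^sub>V / \<bar>y\<^sub>k\<bar>\<close> up to \<open>O(y\<^sub>k\<^bsup>-2\<^esup>)\<close>, as soon as the damped payoff has a finite
  second moment. Multiplied with the density bound, whose exponential part is \<open>O(y\<^sub>k\<^bsup>-2\<^esup>)\<close>, this leaves
  \<open>\<epsilon>\<^sub>D \<epsilon>\<^sub>V / ((y\<^sub>k - \<mu>) y\<^sub>k)\<close>, whose sum is at most the logarithmic term, and an \<open>O(y\<^sub>k\<^bsup>-3\<^esup>)\<close> remainder,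
  whose tail is \<open>O(U\<^bsup>-2\<^esup>)\<close>.

  The second moment is finite because the Fourier transform is analytic near \<open>0\<close> and, the payoff
  having finitely many critical points, the damped payoff has a constant sign near each end of the
  line. If the two signs agree, Fatou's lemma is applied to the kernels \<open>(1 - cos (h y)) / h\<^sup>2\<close>.
  If they differ, an odd kernel with the sign of \<open>y\<close> is needed: an average over \<open>t\<close> of
  \<open>2 sin (t h y) - sin (2 t h y)\<close>, a combination in which the linear terms cancel.
\<close>

section \<open>Summation of the tails\<close>

text \<open>A finite subset of \<open>{u<..}\<close> lies in some \<open>{u<..u + int n}\<close>,
  over which the differences telescope to \<open>\<Psi> u - \<Psi> (u + int n)\<close>.
  Nonnegativity of \<open>\<Psi>\<close> drops the last term, and in \<open>ennreal\<close> a bound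
  on all finite sums bounds the infinite one.\<close>

lemma infsum_le_telescope:
  fixes a \<Psi> :: "int \<Rightarrow> real"
  assumes a: "\<And>k. k > u \<Longrightarrow> 0 \<le> a k" "\<And>k. k > u \<Longrightarrow> a k \<le> \<Psi> (k - 1) - \<Psi> k"
    and \<Psi>: "\<And>k. k \<ge> u \<Longrightarrow> 0 \<le> \<Psi> k"
  shows "(\<Sum>\<^sub>\<infinity>k\<in>{u<..}. ennreal (a k)) \<le> ennreal (\<Psi> u)"
proof (rule infsum_le_finite_sums)
  show "(\<lambda>k. ennreal (a k)) summable_on {u<..}"
    by (intro nonneg_summable_on_complete) auto
next
  fix F assume F: "finite F" "F \<subseteq> {u<..}"
  obtain n :: nat where n: "F \<subseteq> {u<..u + int n}"
  proof -
    have "F \<subseteq> {u<..u + int (nat (Max (insert u F) - u))}"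
      using F by (auto simp: Max_ge)
    then show ?thesis using that by blast
  qed
  have tel: "(\<Sum>k\<in>{u<..u + int n}. a k) \<le> \<Psi> u - \<Psi> (u + int n)" for n
  proof (induction n)
    case (Suc n)
    have "{u<..u + int (Suc n)} = insert (u + int (Suc n)) {u<..u + int n}" by auto
    then show ?case using Suc a(2)[of "u + int (Suc n)"] by simp
  qed simp
  have "(\<Sum>k\<in>F. ennreal (a k)) = ennreal (\<Sum>k\<in>F. a k)"
    using F a(1) by (intro sum_ennreal) auto
  also have "(\<Sum>k\<in>F. a k) \<le> (\<Sum>k\<in>{u<..u + int n}. a k)"
    using n a(1) by (intro sum_mono2) auto
  also have "\<dots> \<le> \<Psi> u" using tel[of n] \<Psi>[of "u + int n"] by simp
  finally show "(\<Sum>k\<in>F. ennreal (a k)) \<le> ennreal (\<Psi> u)"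
    by (simp add: ennreal_leI)
qed

section \<open>Telescoping bounds for the leading and remainder terms\<close>

lemma log_term_plus_nonneg:
  assumes "y > 0" "y > \<mu>"
  shows "0 \<le> log_term_plus \<mu> y"
proof (cases \<mu> "0::real" rule: linorder_cases)
  case less
  then have "ln (y / (y - \<mu>)) \<le> 0" using assms by simp
  with less show ?thesis by (simp add: log_term_plus_def mult_nonpos_nonpos)
next
  case greater
  then have "0 \<le> ln (y / (y - \<mu>))" using assms by simp
  with greater show ?thesis by (simp add: log_term_plus_def)
qed (use assms in \<open>simp add: log_term_plus_def\<close>)

text \<open>Makes the logarithmic term an antiderivative with which the sum over the grid can be
  compared. At \<mu> = 0 the continuous extension 1 / y obeys the same formula.\<close>

lemma DERIV_log_term_plus:
  assumes "y > 0" "y > \<mu>"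
  shows "(log_term_plus \<mu> has_real_derivative - (1 / ((y - \<mu>) * y))) (at y)"
proof (cases "\<mu> = 0")
  case True
  then have "log_term_plus \<mu> = (\<lambda>y. 1 / y)" by (auto simp: log_term_plus_def)
  with assms True show ?thesis
    by (auto intro!: derivative_eq_intros simp: power2_eq_square)
next
  case False
  then have *: "log_term_plus \<mu> = (\<lambda>y. inverse \<mu> * ln (y / (y - \<mu>)))"
    by (auto simp: log_term_plus_def)
  have "((\<lambda>y. y / (y - \<mu>)) has_real_derivative (- \<mu>) / (y - \<mu>)\<^sup>2) (at y)"
    using assms by (auto intro!: derivative_eq_intros simp: power2_eq_square)
  then have "((\<lambda>y. inverse \<mu> * ln (y / (y - \<mu>))) has_real_derivative
      inverse \<mu> * (inverse (y / (y - \<mu>)) * ((- \<mu>) / (y - \<mu>)\<^sup>2))) (at y)"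
    using assms by (intro DERIV_cmult DERIV_chain2[OF DERIV_ln]) auto
  also have "inverse \<mu> * (inverse (y / (y - \<mu>)) * ((- \<mu>) / (y - \<mu>)\<^sup>2)) = - (1 / ((y - \<mu>) * y))"
    using assms False by (simp add: power2_eq_square divide_simps)
  finally show ?thesis unfolding * .
qed

text \<open>By the mean value theorem the right side is \<open>h\<close> times 1 / ((z - \<mu>) z)
  at a point z below \<open>y\<close>, and this function decreases. The right-endpoint rectangle
  thus stays below the integral, with no error term.\<close>

lemma log_term_plus_step:
  assumes "0 < h" "h < y" "\<mu> < y - h"
  shows "h / ((y - \<mu>) * y) \<le> log_term_plus \<mu> (y - h) - log_term_plus \<mu> y"
proof -
  obtain z where z: "y - h < z" "z < y"
    "log_term_plus \<mu> y - log_term_plus \<mu> (y - h) = (y - (y - h)) * - (1 / ((z - \<mu>) * z))"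
    using MVT2[of "y - h" y "log_term_plus \<mu>" "\<lambda>z. - (1 / ((z - \<mu>) * z))"]
      DERIV_log_term_plus[of _ \<mu>] assms by force
  have "(z - \<mu>) * z \<le> (y - \<mu>) * y" using z assms by (intro mult_mono) auto
  then have "h / ((y - \<mu>) * y) \<le> h / ((z - \<mu>) * z)"
    using z assms by (intro divide_left_mono) auto
  with z(3) show ?thesis by simp
qed

text \<open>Over a common denominator this rests on 2 y - h \<ge> y and (y - h)^2 \<le> y^2. It lets
  a cubic remainder telescope to a tail of order U^-2.\<close>

lemma inverse_square_step:
  fixes h y :: real
  assumes "0 < h" "h < y"
  shows "h / y ^ 3 \<le> 1 / (y - h)\<^sup>2 - 1 / y\<^sup>2"
proof -
  have "1 / (y - h)\<^sup>2 - 1 / y\<^sup>2 = (h * (2 * y - h)) / ((y - h)\<^sup>2 * y\<^sup>2)"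
    using assms by (subst diff_frac_eq) (simp, simp, simp add: power2_eq_square right_diff_distrib left_diff_distrib)
  also have "\<dots> \<ge> (h * y) / (y\<^sup>2 * y\<^sup>2)"
    using assms by (intro frac_le mult_right_mono mult_left_mono power_mono) auto
  also have "(h * y) / (y\<^sup>2 * y\<^sup>2) = h / y ^ 3"
    using assms by (simp add: field_simps power2_eq_square power3_eq_cube)
  finally show ?thesis .
qed

text \<open>The left side times t^2 tends to 0, so it is below 1 beyond some \<open>T\<close>, and
  it is bounded on the compact interval [1, T]. This moves the exponential part of the density bound
  into the quadratic error.\<close>

lemma powr_exp_le_inverse_square:
  fixes \<beta> p :: real
  assumes "\<beta> > 0"
  obtains K where "K \<ge> 0" "\<And>t. t \<ge> 1 \<Longrightarrow> t powr p * exp (- \<beta> * t) \<le> K / t\<^sup>2"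
proof -
  have "((\<lambda>t. t powr p * exp (- \<beta> * t) * t\<^sup>2) \<longlongrightarrow> 0) at_top"
    using assms by real_asymp
  then have "eventually (\<lambda>t. t powr p * exp (- \<beta> * t) * t\<^sup>2 < 1) at_top"
    by (rule order_tendstoD) simp
  then obtain T where T: "\<And>t. t \<ge> T \<Longrightarrow> t powr p * exp (- \<beta> * t) * t\<^sup>2 < 1"
    by (auto simp: eventually_at_top_linorder)
  have "continuous_on {1..T} (\<lambda>t. t powr p * exp (- \<beta> * t) * t\<^sup>2)"
    by (intro continuous_intros) auto
  then have "bounded ((\<lambda>t. t powr p * exp (- \<beta> * t) * t\<^sup>2) ` {1..T})"
    by (intro compact_imp_bounded compact_continuous_image) auto
  then obtain B where B: "\<forall>t\<in>{1..T}. \<bar>t powr p * exp (- \<beta> * t) * t\<^sup>2\<bar> \<le> B"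
    unfolding bounded_iff by (metis (no_types, lifting) imageI real_norm_def)
  show ?thesis
  proof (rule that[of "max 1 B"])
    fix t :: real assume t: "t \<ge> 1"
    have "t powr p * exp (- \<beta> * t) * t\<^sup>2 \<le> max 1 B"
      using T[of t] bspec[OF B, of t] t by (cases "t \<ge> T") auto
    then show "t powr p * exp (- \<beta> * t) \<le> max 1 B / t\<^sup>2"
      using t by (simp add: field_simps)
  qed simp
qed

section \<open>The dyadic grid\<close>

lemma grid_minus_one: "grid m (k - 1) = grid m k - 2 powi (- m)"
  by (simp add: grid_def power_int_minus field_simps)

lemma grid_mono: "k \<le> l \<Longrightarrow> grid m k \<le> grid m l"
  by (simp add: grid_def divide_right_mono)

lemma grid_uminus: "grid m (- k) = - grid m k"
  by (simp add: grid_def)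

text \<open>The normalising factors of a density and a payoff coefficient multiply to the grid
  spacing, so the leading products form a Riemann sum.\<close>

lemma two_powr_half_sq: "2 powr (- real_of_int m / 2) * 2 powr (- real_of_int m / 2) = 2 powi (- m)"
proof -
  have "2 powr (- real_of_int m / 2) * 2 powr (- real_of_int m / 2)
      = 2 powr (- real_of_int m / 2 + - real_of_int m / 2)"
    by (rule powr_add[symmetric])
  also have "- real_of_int m / 2 + - real_of_int m / 2 = real_of_int (- m)" by simp
  also have "2 powr real_of_int (- m) = 2 powi (- m)"
    by (rule powr_real_of_int') auto
  finally show ?thesis .
qed

text \<open>The product of the two leading terms is a Riemann sum for the logarithmic term; all
  other products are O(y^-3). \<open>D\<close> and \<open>V\<close> are arbitrary sequences so that
  the left tail follows by reflecting the index.\<close>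

proposition coefficient_tail_bound:
  fixes D V :: "int \<Rightarrow> real" and m :: int
  assumes "C \<ge> 0" "\<epsilon>\<^sub>D \<ge> 0" "\<epsilon>\<^sub>V \<ge> 0" "\<beta> > 0"
    and D: "\<And>k. grid m k - \<mu> > 1 \<Longrightarrow> \<bar>D k\<bar> \<le> 2 powr (- of_int m / 2) *
              (C * (grid m k - \<mu>) powr (\<gamma> - 1) * exp (- \<beta> * (grid m k - \<mu>)) + \<epsilon>\<^sub>D / (grid m k - \<mu>))
              + K\<^sub>D / (grid m k - \<mu>)\<^sup>2"
    and V: "\<And>k. grid m k > 0 \<Longrightarrow>
              \<bar>V k\<bar> \<le> 2 powr (- of_int m / 2) * (\<epsilon>\<^sub>V / grid m k) + K\<^sub>V / (grid m k)\<^sup>2"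
  obtains K where "K \<ge> 0"
    "\<And>u. grid m u > max 0 (1 + \<mu>) \<Longrightarrow> (\<Sum>\<^sub>\<infinity>k\<in>{u<..}. ennreal \<bar>D k * V k\<bar>)
       \<le> ennreal (\<epsilon>\<^sub>D * \<epsilon>\<^sub>V * log_term_plus \<mu> (grid m u)) + ennreal (K / (grid m u)\<^sup>2)"
proof -
  define s :: real where "s = 2 powr (- of_int m / 2)"
  define h :: real where "h = 2 powi (- m)"
  have s: "s > 0" and h: "h > 0" by (simp_all add: s_def h_def)
  have ss: "s * s = h" unfolding s_def h_def by (rule two_powr_half_sq)
  obtain K\<^sub>1 where K\<^sub>1: "K\<^sub>1 \<ge> 0" "\<And>t. t \<ge> 1 \<Longrightarrow> t powr (\<gamma> - 1) * exp (- \<beta> * t) \<le> K\<^sub>1 / t\<^sup>2"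
    using powr_exp_le_inverse_square[OF \<open>\<beta> > 0\<close>, of "\<gamma> - 1"] by blast
  \<comment> \<open>Combines the exponential part, via \<open>K\<^sub>1\<close>, with the given
    error constant; absolute values are taken here and in \<open>K\<^sub>3\<close> because the given
    constants may be negative.\<close>
  define K\<^sub>2 where "K\<^sub>2 = s * C * K\<^sub>1 + \<bar>K\<^sub>D\<bar>"
  define K\<^sub>3 where "K\<^sub>3 = \<bar>K\<^sub>V\<bar>"
  define q where "q = 1 + \<bar>\<mu>\<bar>"
  \<comment> \<open>One summand for each non-leading product, after powers of 1 / t are replaced by
    powers of 1 / y at the cost of \<open>q\<close>.\<close>
  define E where "E = s * \<epsilon>\<^sub>D * K\<^sub>3 * q + s * \<epsilon>\<^sub>V * K\<^sub>2 * q\<^sup>2 + K\<^sub>2 * K\<^sub>3 * q"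
  have K\<^sub>2: "K\<^sub>2 \<ge> 0" and K\<^sub>3: "K\<^sub>3 \<ge> 0" and q: "q \<ge> 1"
    using s assms(1) K\<^sub>1 by (auto simp: K\<^sub>2_def K\<^sub>3_def q_def)
  have E: "E \<ge> 0" using s assms K\<^sub>2 K\<^sub>3 q by (simp add: E_def)
  have term_bound: "\<bar>D k * V k\<bar> \<le> \<epsilon>\<^sub>D * \<epsilon>\<^sub>V * (h / ((y - \<mu>) * y)) + E / y ^ 3"
    if y: "y = grid m k" "y > 0" "y - \<mu> > 1" for k y
  proof -
    define t where "t = y - \<mu>"
    have t: "t > 1" using y by (simp add: t_def)
    have D': "\<bar>D k\<bar> \<le> s * (\<epsilon>\<^sub>D / t) + K\<^sub>2 / t\<^sup>2"
    proof -
      have "\<bar>D k\<bar> \<le> s * (C * (t powr (\<gamma> - 1) * exp (- \<beta> * t)) + \<epsilon>\<^sub>D / t) + K\<^sub>D / t\<^sup>2"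
        using D[of k] t y by (simp add: t_def s_def mult.assoc)
      also have "\<dots> \<le> s * (C * (K\<^sub>1 / t\<^sup>2) + \<epsilon>\<^sub>D / t) + \<bar>K\<^sub>D\<bar> / t\<^sup>2"
        using K\<^sub>1(2)[of t] t s assms(1)
        by (intro add_mono mult_left_mono divide_right_mono order_refl) auto
      also have "\<dots> = s * (\<epsilon>\<^sub>D / t) + K\<^sub>2 / t\<^sup>2"
        by (simp add: K\<^sub>2_def add_divide_distrib algebra_simps)
      finally show ?thesis .
    qed
    have V': "\<bar>V k\<bar> \<le> s * (\<epsilon>\<^sub>V / y) + K\<^sub>3 / y\<^sup>2"
    proof -
      have "\<bar>V k\<bar> \<le> s * (\<epsilon>\<^sub>V / y) + K\<^sub>V / y\<^sup>2" using V[of k] y by (simp add: s_def)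
      also have "K\<^sub>V / y\<^sup>2 \<le> K\<^sub>3 / y\<^sup>2" by (intro divide_right_mono) (auto simp: K\<^sub>3_def)
      finally show ?thesis by simp
    qed
    \<comment> \<open>Here y = t + \<mu>. For \<mu> \<ge> 0 the shift is absorbed through t > 1; for
      negative \<mu> already y < t.\<close>
    have "y \<le> q * t"
    proof (cases "\<mu> \<ge> 0")
      case True
      then have "\<mu> \<le> \<mu> * t" using t by (simp add: mult_le_cancel_left1)
      with True show ?thesis by (simp add: q_def t_def algebra_simps)
    next
      case False
      then have "y \<le> t" by (simp add: t_def)
      also have "t \<le> q * t" using q t by simp
      finally show ?thesis .
    qed
    then have w: "1 / t \<le> q / y" using t y by (simp add: field_simps)
    have w2: "1 / t\<^sup>2 \<le> q\<^sup>2 / y\<^sup>2"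
      using power_mono[OF w, of 2] t by (simp add: power_divide)
    have w1: "1 / t\<^sup>2 \<le> q / y"
    proof -
      have "1 / t\<^sup>2 \<le> 1 / t" using t by (simp add: field_simps power2_eq_square)
      with w show ?thesis by linarith
    qed
    have "\<bar>D k * V k\<bar> \<le> (s * (\<epsilon>\<^sub>D / t) + K\<^sub>2 / t\<^sup>2) * (s * (\<epsilon>\<^sub>V / y) + K\<^sub>3 / y\<^sup>2)"
      unfolding abs_mult using D' V' by (intro mult_mono) auto
    \<comment> \<open>The leading product keeps the denominator t y exactly, since it must match the
      derivative of the logarithmic term.\<close>
    also have "\<dots> = \<epsilon>\<^sub>D * \<epsilon>\<^sub>V * ((s * s) / (t * y)) + (s * \<epsilon>\<^sub>D * K\<^sub>3 / y\<^sup>2 * (1 / t)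
        + s * \<epsilon>\<^sub>V * K\<^sub>2 / y * (1 / t\<^sup>2) + K\<^sub>2 * K\<^sub>3 / y\<^sup>2 * (1 / t\<^sup>2))"
      by (simp add: algebra_simps)
    also have "\<dots> \<le> \<epsilon>\<^sub>D * \<epsilon>\<^sub>V * ((s * s) / (t * y)) + (s * \<epsilon>\<^sub>D * K\<^sub>3 / y\<^sup>2 * (q / y)
        + s * \<epsilon>\<^sub>V * K\<^sub>2 / y * (q\<^sup>2 / y\<^sup>2) + K\<^sub>2 * K\<^sub>3 / y\<^sup>2 * (q / y))"
      using w w1 w2 s assms(1-3) K\<^sub>2 K\<^sub>3 y by (intro add_mono mult_left_mono order_refl) auto
    also have "\<dots> = \<epsilon>\<^sub>D * \<epsilon>\<^sub>V * (h / (t * y)) + E / y ^ 3"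
      by (simp add: E_def ss add_divide_distrib power2_eq_square power3_eq_cube mult_ac)
    finally show ?thesis by (simp add: t_def)
  qed
  show ?thesis
  proof (rule that[of "E / h"])
    show "E / h \<ge> 0" using E h by simp
    fix u assume U: "grid m u > max 0 (1 + \<mu>)"
    \<comment> \<open>Dividing \<open>E\<close> by \<open>h\<close> compensates the factor
      \<open>h\<close> in the telescoping bound for h / y^3.\<close>
    define \<Psi> where "\<Psi> k = \<epsilon>\<^sub>D * \<epsilon>\<^sub>V * log_term_plus \<mu> (grid m k) + E / h * (1 / (grid m k)\<^sup>2)" for k
    have "(\<Sum>\<^sub>\<infinity>k\<in>{u<..}. ennreal \<bar>D k * V k\<bar>) \<le> ennreal (\<Psi> u)"
    proof (rule infsum_le_telescope)
      fix k assume k: "k > u"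
      define y where "y = grid m k"
      have yh: "grid m (k - 1) = y - h" by (simp add: y_def h_def grid_minus_one)
      \<comment> \<open>Because k > u is strict, the whole step from y - h to y lies at or beyond U,
        where the telescoping estimates are valid.\<close>
      have "grid m u \<le> y - h" unfolding yh[symmetric] using k by (intro grid_mono) auto
      with U have y: "y - h > 0" "y - h - \<mu> > 1" by auto
      have "\<bar>D k * V k\<bar> \<le> \<epsilon>\<^sub>D * \<epsilon>\<^sub>V * (h / ((y - \<mu>) * y)) + E / y ^ 3"
        using y h by (intro term_bound) (auto simp: y_def)
      also have "E / y ^ 3 = E / h * (h / y ^ 3)" using h by simp
      also have "\<epsilon>\<^sub>D * \<epsilon>\<^sub>V * (h / ((y - \<mu>) * y)) + E / h * (h / y ^ 3)
         \<le> \<epsilon>\<^sub>D * \<epsilon>\<^sub>V * (log_term_plus \<mu> (y - h) - log_term_plus \<mu> y) + E / h * (1 / (y - h)\<^sup>2 - 1 / y\<^sup>2)"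
        using y h E assms(2,3)
        by (intro add_mono mult_left_mono log_term_plus_step inverse_square_step) auto
      also have "\<dots> = \<Psi> (k - 1) - \<Psi> k"
        unfolding \<Psi>_def yh y_def[symmetric] by (simp only: right_diff_distrib add_diff_add)
      finally show "\<bar>D k * V k\<bar> \<le> \<Psi> (k - 1) - \<Psi> k" .
    next
      fix k assume "k \<ge> u"
      then have "grid m u \<le> grid m k" by (rule grid_mono)
      with U E h assms(2,3) show "\<Psi> k \<ge> 0"
        unfolding \<Psi>_def by (intro add_nonneg_nonneg mult_nonneg_nonneg log_term_plus_nonneg) auto
    qed simp
    also have "\<dots> = ennreal (\<epsilon>\<^sub>D * \<epsilon>\<^sub>V * log_term_plus \<mu> (grid m u)) + ennreal (E / h / (grid m u)\<^sup>2)"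
      using U E h assms(2,3) by (subst ennreal_plus[symmetric])
        (auto simp: \<Psi>_def intro!: mult_nonneg_nonneg log_term_plus_nonneg)
    finally show "(\<Sum>\<^sub>\<infinity>k\<in>{u<..}. ennreal \<bar>D k * V k\<bar>)
       \<le> ennreal (\<epsilon>\<^sub>D * \<epsilon>\<^sub>V * log_term_plus \<mu> (grid m u)) + ennreal (E / h / (grid m u)\<^sup>2)" .
  qed
qed

section \<open>Decay of sinc coefficients\<close>

lemma integrable_mult_bounded:
  fixes g k :: "real \<Rightarrow> real"
  assumes g: "integrable lborel g" and k: "k \<in> borel_measurable borel" "\<And>y. \<bar>k y\<bar> \<le> c"
  shows "integrable lborel (\<lambda>y. g y * k y)"
proof (rule Bochner_Integration.integrable_bound)
  show "integrable lborel (\<lambda>y. c * g y)" using g by simp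
  show "(\<lambda>y. g y * k y) \<in> borel_measurable lborel"
    using g k by (intro borel_measurable_times) auto
  have "0 \<le> c" using k(2)[of 0] by linarith
  then show "AE y in lborel. norm (g y * k y) \<le> norm (c * g y)"
    using mult_right_mono[OF k(2) abs_ge_zero] by (simp add: abs_mult mult.commute)
qed

text \<open>Dominated by |g| + |y^q g|, because |y|^p \<le> 1 + |y|^q for p \<le> q.\<close>

lemma integrable_lower_moment:
  fixes g :: "real \<Rightarrow> real"
  assumes g: "integrable lborel g" and q: "integrable lborel (\<lambda>y. y ^ q * g y)" and "p \<le> q"
  shows "integrable lborel (\<lambda>y. y ^ p * g y)"
proof (rule Bochner_Integration.integrable_bound)
  show "integrable lborel (\<lambda>y. \<bar>g y\<bar> + \<bar>y ^ q * g y\<bar>)"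
    using assms by (intro Bochner_Integration.integrable_add integrable_abs)
  show "(\<lambda>y. y ^ p * g y) \<in> borel_measurable lborel" using g by measurable
  have "\<bar>y\<bar> ^ p \<le> 1 + \<bar>y\<bar> ^ q" for y :: real
  proof (cases "\<bar>y\<bar> \<le> 1")
    case True
    then have "\<bar>y\<bar> ^ p \<le> 1" by (simp add: power_le_one)
    then show ?thesis by (smt (verit) zero_le_power abs_ge_zero)
  next
    case False
    then have "\<bar>y\<bar> ^ p \<le> \<bar>y\<bar> ^ q" using \<open>p \<le> q\<close> by (intro power_increasing) auto
    then show ?thesis by simp
  qed
  from mult_right_mono[OF this abs_ge_zero]
  show "AE y in lborel. norm (y ^ p * g y) \<le> norm (\<bar>g y\<bar> + \<bar>y ^ q * g y\<bar>)"
    by (simp add: abs_mult power_abs algebra_simps)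
qed

lemma nsinc_mult: "pi * x * nsinc x = sin (pi * x)"
  by (simp add: nsinc_def)

lemma abs_nsinc_le_one: "\<bar>nsinc x\<bar> \<le> 1"
proof (cases "x = 0")
  case False
  have "\<bar>sin (pi * x)\<bar> \<le> \<bar>pi * x\<bar>" by (rule abs_sin_x_le_abs_x)
  with False show ?thesis by (simp add: nsinc_def divide_le_eq_1)
qed (simp add: nsinc_def)

lemma borel_measurable_nsinc [measurable]: "nsinc \<in> borel_measurable borel"
  unfolding nsinc_def[abs_def] by measurable

text \<open>With Y the grid point, Y^2 = y^2 - (y + Y) (y - Y), and the factor y - Y cancels the
  denominator of the sinc function. Hence Y^2 times the coefficient is a bounded part plus a
  multiple of Y times the sine integral, which is the leading term.\<close>

proposition sinc_coefficient_decay: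
  fixes g :: "real \<Rightarrow> real" and m :: int
  assumes g: "integrable lborel g" and g2: "integrable lborel (\<lambda>y. y\<^sup>2 * g y)"
  obtains K where "K \<ge> 0" "\<And>k. grid m k \<noteq> 0 \<Longrightarrow> \<bar>LBINT y. g y * phi m k y\<bar> \<le>
     2 powr (- of_int m / 2) * (\<bar>LBINT y. g y * sin (2 powi m * pi * y)\<bar> / pi / \<bar>grid m k\<bar>)
     + K / (grid m k)\<^sup>2"
proof -
  define w :: real where "w = 2 powi m"
  define S where "S = (LBINT y. g y * sin (w * pi * y))"
  define q :: real where "q = 2 powr (of_int m / 2)"
  \<comment> \<open>The second moment bounds the part that still contains the sinc function, the
    first moment the part with y sin (w pi y).\<close>
  define K\<^sub>0 where "K\<^sub>0 = (LBINT y. \<bar>y\<^sup>2 * g y\<bar>) + 1 / (pi * w) * (LBINT y. \<bar>y * g y\<bar>)"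
  have w: "w > 0" and q: "q > 0" by (simp_all add: w_def q_def)
  have qw: "q / w = 2 powr (- of_int m / 2)"
    using two_powr_half_sq[of m] w
    by (simp add: q_def w_def powr_minus power_int_minus field_simps)
  have g1: "integrable lborel (\<lambda>y. y * g y)"
    using integrable_lower_moment[OF g g2, of 1] by simp
  have K\<^sub>0: "K\<^sub>0 \<ge> 0"
    unfolding K\<^sub>0_def using w by (intro add_nonneg_nonneg mult_nonneg_nonneg integral_nonneg) auto
  have main: "\<bar>LBINT y. g y * phi m k y\<bar> \<le> q / w * (\<bar>S\<bar> / pi / \<bar>Y\<bar>) + q * K\<^sub>0 / Y\<^sup>2"
    if Y: "Y = grid m k" "Y \<noteq> 0" for k Y
  proof -
    define n where "n y = nsinc (w * y - of_int k)" for y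
    define c where "c = cos (pi * of_int k) / (pi * w)"
    have wY: "w * Y = of_int k" using w by (simp add: Y grid_def w_def)
    \<comment> \<open>The sine vanishes at integer multiples of pi, so the cosine is 1 or -1 and |c|
      does not depend on \<open>k\<close>.\<close>
    have "\<bar>cos (pi * real_of_int k)\<bar> = 1"
      using sin_cos_squared_add[of "pi * real_of_int k"] sin_integer_2pi[of k] sin_npi_int[of k]
      by (simp add: abs_square_eq_1)
    then have c: "\<bar>c\<bar> = 1 / (pi * w)" using w by (simp add: c_def abs_mult)
    have n1: "\<bar>n y\<bar> \<le> 1" for y by (simp add: n_def abs_nsinc_le_one)
    have n_meas [measurable]: "n \<in> borel_measurable borel" unfolding n_def by measurable
    \<comment> \<open>Since w Y is the integer \<open>k\<close>, the addition formula leaves only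
      cos (pi k) sin (w pi y).\<close>
    have key: "(y - Y) * n y = c * sin (w * pi * y)" for y
    proof -
      have "pi * w * ((y - Y) * n y) = pi * (w * y - of_int k) * n y"
        using wY by (simp add: algebra_simps)
      also have "\<dots> = sin (pi * (w * y) - pi * of_int k)"
        unfolding n_def nsinc_mult by (simp add: right_diff_distrib)
      also have "\<dots> = pi * w * (c * sin (w * pi * y))"
        using w by (simp add: sin_diff c_def sin_npi_int mult_ac)
      finally show ?thesis using w by simp
    qed
    have expand: "Y\<^sup>2 * (g y * n y) = y\<^sup>2 * g y * n y - c * (y * g y * sin (w * pi * y))
        - Y * c * (g y * sin (w * pi * y))" for y
    proof -
      have "Y\<^sup>2 * n y = y\<^sup>2 * n y - (y + Y) * ((y - Y) * n y)"
        by (simp add: power2_eq_square algebra_simps)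
      also have "\<dots> = y\<^sup>2 * n y - c * (y * sin (w * pi * y)) - Y * c * sin (w * pi * y)"
        unfolding key by (simp add: algebra_simps)
      finally have "g y * (Y\<^sup>2 * n y)
          = g y * (y\<^sup>2 * n y - c * (y * sin (w * pi * y)) - Y * c * sin (w * pi * y))"
        by simp
      then show ?thesis by (simp add: algebra_simps)
    qed
    have i2: "integrable lborel (\<lambda>y. y\<^sup>2 * g y * n y)"
      using g2 n_meas n1 by (rule integrable_mult_bounded)
    have i1: "integrable lborel (\<lambda>y. y * g y * sin (w * pi * y))"
      using g1 by (rule integrable_mult_bounded[where c = 1]) auto
    have i0: "integrable lborel (\<lambda>y. g y * sin (w * pi * y))"
      using g by (rule integrable_mult_bounded[where c = 1]) auto
    have "Y\<^sup>2 * (LBINT y. g y * n y) = (LBINT y. Y\<^sup>2 * (g y * n y))" by simp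
    also have "\<dots> = (LBINT y. y\<^sup>2 * g y * n y) - c * (LBINT y. y * g y * sin (w * pi * y)) - Y * c * S"
      unfolding expand S_def using i0 i1 i2 by simp
    finally have eq: "Y\<^sup>2 * (LBINT y. g y * n y)
      = (LBINT y. y\<^sup>2 * g y * n y) - c * (LBINT y. y * g y * sin (w * pi * y)) - Y * c * S" .
    have b2: "\<bar>LBINT y. y\<^sup>2 * g y * n y\<bar> \<le> (LBINT y. \<bar>y\<^sup>2 * g y\<bar>)"
    proof -
      have "\<bar>LBINT y. y\<^sup>2 * g y * n y\<bar> \<le> (LBINT y. \<bar>y\<^sup>2 * g y * n y\<bar>)"
        by (rule integral_abs_bound)
      also have "\<dots> \<le> (LBINT y. \<bar>y\<^sup>2 * g y\<bar>)"
      proof (intro integral_mono integrable_abs i2 g2)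
        show "\<bar>y\<^sup>2 * g y * n y\<bar> \<le> \<bar>y\<^sup>2 * g y\<bar>" for y
          using mult_left_mono[OF n1[of y] abs_ge_zero[of "y\<^sup>2 * g y"]] by (simp add: abs_mult)
      qed
      finally show ?thesis .
    qed
    have b1: "\<bar>LBINT y. y * g y * sin (w * pi * y)\<bar> \<le> (LBINT y. \<bar>y * g y\<bar>)"
    proof -
      have "\<bar>LBINT y. y * g y * sin (w * pi * y)\<bar> \<le> (LBINT y. \<bar>y * g y * sin (w * pi * y)\<bar>)"
        by (rule integral_abs_bound)
      also have "\<dots> \<le> (LBINT y. \<bar>y * g y\<bar>)"
      proof (intro integral_mono integrable_abs i1 g1)
        show "\<bar>y * g y * sin (w * pi * y)\<bar> \<le> \<bar>y * g y\<bar>" for y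
          using mult_left_mono[OF abs_sin_le_one abs_ge_zero[of "y * g y"]] by (simp add: abs_mult)
      qed
      finally show ?thesis .
    qed
    have "Y\<^sup>2 * \<bar>LBINT y. g y * n y\<bar> = \<bar>Y\<^sup>2 * (LBINT y. g y * n y)\<bar>" by (simp add: abs_mult)
    also have "\<dots> \<le> \<bar>LBINT y. y\<^sup>2 * g y * n y\<bar> + \<bar>c\<bar> * \<bar>LBINT y. y * g y * sin (w * pi * y)\<bar>
        + \<bar>Y\<bar> * \<bar>c\<bar> * \<bar>S\<bar>"
      unfolding eq abs_mult[symmetric] by linarith
    also have "\<dots> \<le> K\<^sub>0 + \<bar>Y\<bar> * \<bar>c\<bar> * \<bar>S\<bar>"
      unfolding K\<^sub>0_def c using b2 b1 w by (intro add_mono mult_left_mono order_refl) auto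
    finally have "\<bar>LBINT y. g y * n y\<bar> \<le> (K\<^sub>0 + \<bar>Y\<bar> * \<bar>c\<bar> * \<bar>S\<bar>) / Y\<^sup>2"
      using Y(2) by (simp add: pos_le_divide_eq mult.commute)
    also have "\<dots> = K\<^sub>0 / Y\<^sup>2 + \<bar>S\<bar> / (pi * w) / \<bar>Y\<bar>"
    proof -
      have "Y\<^sup>2 = \<bar>Y\<bar> * \<bar>Y\<bar>" by (simp add: power2_eq_square)
      then have "\<bar>Y\<bar> * \<bar>c\<bar> * \<bar>S\<bar> / Y\<^sup>2 = \<bar>c\<bar> * \<bar>S\<bar> / \<bar>Y\<bar>"
        using Y(2) by (simp only: mult.assoc mult_divide_mult_cancel_left_if abs_eq_0) simp
      then show ?thesis unfolding add_divide_distrib c by simp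
    qed
    finally have n_bound: "\<bar>LBINT y. g y * n y\<bar> \<le> K\<^sub>0 / Y\<^sup>2 + \<bar>S\<bar> / (pi * w) / \<bar>Y\<bar>" .
    have "(LBINT y. g y * phi m k y) = (LBINT y. q * (g y * n y))"
      by (simp add: phi_def q_def n_def w_def mult_ac)
    also have "\<dots> = q * (LBINT y. g y * n y)" by simp
    finally have "\<bar>LBINT y. g y * phi m k y\<bar> = q * \<bar>LBINT y. g y * n y\<bar>"
      using q by (simp add: abs_mult)
    also have "\<dots> \<le> q * (K\<^sub>0 / Y\<^sup>2 + \<bar>S\<bar> / (pi * w) / \<bar>Y\<bar>)"
      using q n_bound by (intro mult_left_mono) auto
    also have "\<dots> = q / w * (\<bar>S\<bar> / pi / \<bar>Y\<bar>) + q * K\<^sub>0 / Y\<^sup>2"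
      by (simp add: distrib_left mult_ac)
    finally show ?thesis .
  qed
  show ?thesis
  proof (rule that[of "q * K\<^sub>0"])
    show "0 \<le> q * K\<^sub>0" using q K\<^sub>0 by simp
  qed (rule main[unfolded qw, unfolded S_def w_def, OF refl])
qed

section \<open>Real and imaginary parts of Fourier transforms\<close>

lemma integrable_fourier_integrand:
  assumes "integrable lborel g"
  shows "integrable lborel (\<lambda>y. of_real (g y) * exp (- \<i> * of_real h * of_real y))"
proof (rule Bochner_Integration.integrable_bound[OF assms])
  show "(\<lambda>y. of_real (g y) * exp (- \<i> * of_real h * of_real y)) \<in> borel_measurable lborel"
    using assms by measurable
qed (simp add: norm_mult)

lemma Re_fourier_of_real:
  assumes "integrable lborel g"
  shows "Re (fourier g (of_real h)) = (LBINT y. g y * cos (h * y))"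
proof -
  have "Re (fourier g (of_real h)) = (LBINT y. Re (of_real (g y) * exp (- \<i> * of_real h * of_real y)))"
    unfolding fourier_def by (rule integral_Re[symmetric, OF integrable_fourier_integrand[OF assms]])
  also have "\<dots> = (LBINT y. g y * cos (h * y))" by (simp add: Re_exp)
  finally show ?thesis .
qed

lemma Im_fourier_of_real:
  assumes "integrable lborel g"
  shows "Im (fourier g (of_real h)) = - (LBINT y. g y * sin (h * y))"
proof -
  have "Im (fourier g (of_real h)) = (LBINT y. Im (of_real (g y) * exp (- \<i> * of_real h * of_real y)))"
    unfolding fourier_def by (rule integral_Im[symmetric, OF integrable_fourier_integrand[OF assms]])
  also have "\<dots> = (LBINT y. - (g y * sin (h * y)))" by (simp add: Im_exp)
  finally show ?thesis by simp
qed

section \<open>Second moments and analytic Fourier transforms\<close>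

text \<open>Taylor's theorem of order two, the third derivative being bounded on the smaller closed
  disc by compactness.\<close>

lemma holomorphic_quadratic_approximation:
  assumes F: "F holomorphic_on ball 0 c" and "c > 0"
  obtains B a\<^sub>1 a\<^sub>2 where "B \<ge> 0"
    "\<And>z. z \<in> cball 0 (c / 2) \<Longrightarrow> norm (F z - (F 0 + a\<^sub>1 * z + a\<^sub>2 * z\<^sup>2)) \<le> B * norm z ^ 3"
proof -
  have hol: "(deriv ^^ i) F holomorphic_on ball 0 c" for i
    by (rule holomorphic_higher_deriv[OF F]) simp
  have sub: "cball 0 (c / 2) \<subseteq> ball (0::complex) c" using \<open>c > 0\<close> by auto
  have "bounded ((deriv ^^ 3) F ` cball 0 (c / 2))"
    by (intro compact_imp_bounded compact_continuous_image compact_cball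
        continuous_on_subset[OF holomorphic_on_imp_continuous_on[OF hol] sub])
  then obtain B where "B > 0" "\<forall>w\<in>(deriv ^^ 3) F ` cball 0 (c / 2). norm w \<le> B"
    by (auto simp only: bounded_pos)
  then have B: "B > 0" "norm ((deriv ^^ 3) F z) \<le> B" if "z \<in> cball 0 (c / 2)" for z
    using that by auto
  have "norm (F z - (F 0 + deriv F 0 * z + (deriv (deriv F) 0 / 2) * z\<^sup>2)) \<le> B / 2 * norm z ^ 3"
    if z: "z \<in> cball 0 (c / 2)" for z
  proof -
    \<comment> \<open>The remainder estimate divides by \<open>fact 2\<close>, whence the constant B
      / 2.\<close>
    have "norm ((deriv ^^ 0) F z - (\<Sum>i\<le>2. (deriv ^^ i) F 0 * (z - 0) ^ i / fact i))
        \<le> B * norm (z - 0) ^ Suc 2 / fact 2"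
    proof (rule complex_Taylor[of "cball 0 (c / 2)"])
      fix i x assume "x \<in> cball (0::complex) (c / 2)"
      then have "x \<in> ball 0 c" by (rule subsetD[OF sub])
      then show "((deriv ^^ i) F has_field_derivative (deriv ^^ Suc i) F x) (at x within cball 0 (c / 2))"
        using holomorphic_derivI[OF hol[of i] open_ball] by simp
    next
      fix x assume "x \<in> cball (0::complex) (c / 2)"
      then show "cmod ((deriv ^^ Suc 2) F x) \<le> B" using B(2)[of x] by (simp add: numeral_3_eq_3 numeral_2_eq_2)
    qed (use z \<open>c > 0\<close> in auto)
    then show ?thesis by (simp add: numeral_2_eq_2 numeral_3_eq_3)
  qed
  moreover have "B > 0" using B(1)[of 0] \<open>c > 0\<close> by simp
  ultimately show ?thesis by (intro that[of "B / 2" "deriv F 0" "deriv (deriv F) 0 / 2"]) auto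
qed

text \<open>In 2 F(0) - F(h) - F(-h) the constant and linear terms cancel and O(h^2) remains; in 2
  (F(h) - F(-h)) - (F(2h) - F(-2h)) everything up to second order cancels and O(h^3) remains. As
  \<open>g\<close> is real, the real and imaginary parts are twice the cosine and minus twice the
  sine integral.\<close>

lemma holomorphic_transform_differences:
  assumes g: "integrable lborel g" and F: "F holomorphic_on ball 0 c" "c > 0"
    and Fg: "\<And>x::real. F (of_real x) = fourier g (of_real x)"
  obtains B d where "B \<ge> 0" "d > 0"
    "\<And>h. 0 \<le> h \<Longrightarrow> h \<le> d \<Longrightarrow> \<bar>LBINT y. g y * (1 - cos (h * y))\<bar> \<le> B * h\<^sup>2"
    "\<And>h. 0 \<le> h \<Longrightarrow> h \<le> d \<Longrightarrow> \<bar>LBINT y. g y * (2 * sin (h * y) - sin (2 * (h * y)))\<bar> \<le> B * h ^ 3"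
proof -
  obtain B a\<^sub>1 a\<^sub>2 where B: "B \<ge> 0"
    "\<And>z. z \<in> cball 0 (c / 2) \<Longrightarrow> norm (F z - (F 0 + a\<^sub>1 * z + a\<^sub>2 * z\<^sup>2)) \<le> B * norm z ^ 3"
    using holomorphic_quadratic_approximation[OF F] by blast
  define R where "R z = F z - (F 0 + a\<^sub>1 * z + a\<^sub>2 * z\<^sup>2)" for z
  \<comment> \<open>The quarter keeps the points 2 h and -2 h in the disc of radius c / 2; d \<le> 1
    gives h^3 \<le> h^2.\<close>
  define d where "d = min 1 (c / 4)"
  have d: "d > 0" "d \<le> 1" "2 * d \<le> c / 2" using F(2) by (auto simp: d_def)
  have R: "norm (R (of_real x)) \<le> B * \<bar>x\<bar> ^ 3" if "\<bar>x\<bar> \<le> 2 * d" for x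
    using B(2)[of "of_real x"] that d by (simp add: R_def)
  have cos_int: "integrable lborel (\<lambda>y. g y * cos (x * y))" for x
    by (rule integrable_mult_bounded[OF g, where c = 1]) auto
  have sin_int: "integrable lborel (\<lambda>y. g y * sin (x * y))" for x
    by (rule integrable_mult_bounded[OF g, where c = 1]) auto
  define C where "C x = (LBINT y. g y * cos (x * y))" for x
  define S where "S x = (LBINT y. g y * sin (x * y))" for x
  have ReF: "Re (F (of_real x)) = C x" and ImF: "Im (F (of_real x)) = - S x" for x
    using Re_fourier_of_real[OF g, of x] Im_fourier_of_real[OF g, of x]
    by (simp_all add: Fg C_def S_def)
  have C_even: "C (- x) = C x" and S_odd: "S (- x) = - S x" for x
    by (simp_all add: C_def S_def)
  show ?thesis
  \<comment> \<open>One constant for both bounds: 20 = 2 + 2 + 8 + 8 counts the Taylor remainders at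
    h, -h, 2 h and -2 h.\<close>
  proof (rule that[of "20 * B + 2 * norm a\<^sub>2" d])
    show "0 \<le> 20 * B + 2 * cmod a\<^sub>2" using B(1) by simp
    show "d > 0" by (rule d)
    fix h :: real assume h: "0 \<le> h" "h \<le> d"
    have "h ^ 3 \<le> h ^ 2" using h d by (intro power_decreasing) auto
    have e1: "(LBINT y. g y * (1 - cos (h * y))) = C 0 - C h"
      unfolding C_def using g cos_int[of h] by (simp add: right_diff_distrib)
    have n1: "norm (2 * F 0 - F (of_real h) - F (of_real (- h))) \<le> (2 * B + 2 * norm a\<^sub>2) * h\<^sup>2"
    proof -
      have "2 * F 0 - F (of_real h) - F (of_real (- h))
          = - (R (of_real h) + R (of_real (- h)) + 2 * a\<^sub>2 * of_real h ^ 2)"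
        by (simp add: R_def)
      also have "norm \<dots> \<le> norm (R (of_real h)) + norm (R (of_real (- h))) + norm (2 * a\<^sub>2 * of_real h ^ 2)"
        unfolding norm_minus_cancel by (intro norm_triangle_le add_mono order_refl)
      also have "\<dots> \<le> B * h ^ 3 + B * h ^ 3 + 2 * norm a\<^sub>2 * h\<^sup>2"
        using R[of h] R[of "- h"] h d by (intro add_mono) (auto simp: norm_mult norm_power)
      also have "\<dots> \<le> B * h ^ 2 + B * h ^ 2 + 2 * norm a\<^sub>2 * h\<^sup>2"
        using B(1) \<open>h ^ 3 \<le> h ^ 2\<close> by (intro add_mono mult_left_mono order_refl) auto
      finally show ?thesis by (simp add: algebra_simps)
    qed
    have r1: "Re (2 * F 0 - F (of_real h) - F (of_real (- h))) = 2 * (C 0 - C h)"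
      using ReF[of 0] ReF[of h] ReF[of "- h"] C_even[of h] by simp
    have "\<bar>2 * (LBINT y. g y * (1 - cos (h * y)))\<bar> \<le> (2 * B + 2 * norm a\<^sub>2) * h\<^sup>2"
      unfolding e1 r1[symmetric] by (rule order_trans[OF abs_Re_le_cmod n1])
    also have "\<dots> \<le> (2 * (20 * B + 2 * norm a\<^sub>2)) * h\<^sup>2"
      using B(1) by (intro mult_right_mono) auto
    finally show "\<bar>LBINT y. g y * (1 - cos (h * y))\<bar> \<le> (20 * B + 2 * norm a\<^sub>2) * h\<^sup>2"
      by (simp only: abs_mult abs_numeral abs_minus_cancel mult.assoc mult_le_cancel_left_pos zero_less_numeral)
    have e2: "(LBINT y. g y * (2 * sin (h * y) - sin (2 * (h * y)))) = 2 * S h - S (2 * h)"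
    proof -
      have "(\<lambda>y. g y * (2 * sin (h * y) - sin (2 * (h * y))))
          = (\<lambda>y. 2 * (g y * sin (h * y)) - g y * sin (2 * h * y))"
        by (simp only: right_diff_distrib mult.left_commute mult.assoc)
      then show ?thesis unfolding S_def using sin_int[of h] sin_int[of "2 * h"] by simp
    qed
    have n2: "norm (2 * F (of_real h) - 2 * F (of_real (- h)) - (F (of_real (2 * h)) - F (of_real (- (2 * h)))))
        \<le> 20 * B * h ^ 3"
    proof -
      have "2 * F (of_real h) - 2 * F (of_real (- h)) - (F (of_real (2 * h)) - F (of_real (- (2 * h))))
        = 2 * R (of_real h) - 2 * R (of_real (- h)) - (R (of_real (2 * h)) - R (of_real (- (2 * h))))"
        unfolding R_def of_real_minus of_real_mult of_real_numeral by algebra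
      also have "norm \<dots> \<le> norm (2 * R (of_real h)) + norm (2 * R (of_real (- h)))
          + (norm (R (of_real (2 * h))) + norm (R (of_real (- (2 * h)))))"
        by (intro order_trans[OF norm_triangle_ineq4] add_mono order_refl norm_triangle_ineq4)
      also have "\<dots> \<le> 2 * (B * h ^ 3) + 2 * (B * h ^ 3) + (B * (2 * h) ^ 3 + B * (2 * h) ^ 3)"
        using R[of h] R[of "- h"] R[of "2 * h"] R[of "- (2 * h)"] h d
        by (intro add_mono) (auto simp: norm_mult)
      finally show ?thesis by (simp add: power_mult_distrib)
    qed
    have i2: "Im (2 * F (of_real h) - 2 * F (of_real (- h)) - (F (of_real (2 * h)) - F (of_real (- (2 * h)))))
        = - 2 * (2 * S h - S (2 * h))"
      using ImF[of h] ImF[of "- h"] ImF[of "2 * h"] ImF[of "- (2 * h)"] S_odd[of h] S_odd[of "2 * h"]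
      by simp
    have "\<bar>- 2 * (LBINT y. g y * (2 * sin (h * y) - sin (2 * (h * y))))\<bar> \<le> 20 * B * h ^ 3"
      unfolding e2 i2[symmetric] by (rule order_trans[OF abs_Im_le_cmod n2])
    also have "\<dots> \<le> (2 * (20 * B + 2 * norm a\<^sub>2)) * h ^ 3"
      using B(1) h by (intro mult_right_mono) auto
    finally show "\<bar>LBINT y. g y * (2 * sin (h * y) - sin (2 * (h * y)))\<bar> \<le> (20 * B + 2 * norm a\<^sub>2) * h ^ 3"
      by (simp only: abs_mult abs_numeral abs_minus_cancel mult.assoc mult_le_cancel_left_pos zero_less_numeral)
  qed
qed

text \<open>Fatou's lemma after adding c |g|, which makes the integrands nonnegative: for |y| \<le>
  R by the bound on the kernels, beyond by the sign condition. Upper bounds on the signed integrals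
  then suffice.\<close>

lemma integrable_kernel_limit:
  fixes g \<kappa> :: "real \<Rightarrow> real" and \<kappa>' :: "nat \<Rightarrow> real \<Rightarrow> real"
  assumes g: "integrable lborel g"
    and int: "\<And>n. integrable lborel (\<lambda>y. g y * \<kappa>' n y)"
    and le: "\<And>n. (LBINT y. g y * \<kappa>' n y) \<le> B"
    and bnd: "\<And>n y. \<bar>y\<bar> \<le> R \<Longrightarrow> \<bar>\<kappa>' n y\<bar> \<le> c"
    and sgn: "\<And>n y. \<bar>y\<bar> > R \<Longrightarrow> 0 \<le> g y * \<kappa>' n y"
    and lim: "\<And>y. (\<lambda>n. \<kappa>' n y) \<longlonglongrightarrow> \<kappa> y"
    and c: "c \<ge> 0"
  shows "integrable lborel (\<lambda>y. g y * \<kappa> y)"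
proof -
  define f' where "f' n y = g y * \<kappa>' n y + c * \<bar>g y\<bar>" for n y
  define f where "f y = g y * \<kappa> y + c * \<bar>g y\<bar>" for y
  have f'_nonneg: "0 \<le> f' n y" for n y
  proof (cases "\<bar>y\<bar> \<le> R")
    case True
    have "\<bar>g y * \<kappa>' n y\<bar> \<le> c * \<bar>g y\<bar>"
      using mult_right_mono[OF bnd[OF True] abs_ge_zero[of "g y"]] by (simp add: abs_mult mult.commute)
    then show ?thesis by (simp add: f'_def)
  next
    case False
    then show ?thesis using sgn[of y n] c by (simp add: f'_def)
  qed
  have f'_int: "integrable lborel (f' n)" for n
    unfolding f'_def using g int by (intro Bochner_Integration.integrable_add) auto
  have f'_lim: "(\<lambda>n. f' n y) \<longlonglongrightarrow> f y" for y
    unfolding f'_def f_def by (intro tendsto_intros lim)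
  have f_meas: "f \<in> borel_measurable lborel"
  proof (rule borel_measurable_LIMSEQ_metric)
    show "f' n \<in> borel_measurable lborel" for n using f'_int by (rule borel_measurable_integrable)
  qed (rule f'_lim)
  have f_nonneg: "0 \<le> f y" for y
    by (rule LIMSEQ_le_const[OF f'_lim]) (use f'_nonneg in auto)
  have f'_le: "(\<integral>\<^sup>+y. ennreal (f' n y) \<partial>lborel) \<le> ennreal (B + c * (LBINT y. \<bar>g y\<bar>))" for n
  proof -
    have "(LBINT y. f' n y) = (LBINT y. g y * \<kappa>' n y) + (LBINT y. c * \<bar>g y\<bar>)"
      unfolding f'_def using g int[of n] by (intro Bochner_Integration.integral_add) auto
    then have "(LBINT y. f' n y) \<le> B + c * (LBINT y. \<bar>g y\<bar>)"
      using le[of n] by simp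
    moreover have "(\<integral>\<^sup>+y. ennreal (f' n y) \<partial>lborel) = ennreal (LBINT y. f' n y)"
      using f'_int f'_nonneg by (intro nn_integral_eq_integral) auto
    ultimately show ?thesis by (simp add: ennreal_leI)
  qed
  have "(\<integral>\<^sup>+y. ennreal (f y) \<partial>lborel) = (\<integral>\<^sup>+y. liminf (\<lambda>n. ennreal (f' n y)) \<partial>lborel)"
    by (intro nn_integral_cong lim_imp_Liminf[symmetric] tendsto_ennrealI f'_lim) simp
  also have "\<dots> \<le> liminf (\<lambda>n. \<integral>\<^sup>+y. ennreal (f' n y) \<partial>lborel)"
    using f'_int by (intro nn_integral_liminf) auto
  also have "\<dots> \<le> ennreal (B + c * (LBINT y. \<bar>g y\<bar>))"
    using Liminf_le[OF sequentially_bot, of "\<lambda>n. \<integral>\<^sup>+y. ennreal (f' n y) \<partial>lborel"] f'_le by simp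
  finally have "(\<integral>\<^sup>+y. ennreal (f y) \<partial>lborel) < \<infinity>"
    by (rule le_less_trans) simp
  then have "integrable lborel f"
    using f_meas f_nonneg by (intro integrableI_nonneg) auto
  then have "integrable lborel (\<lambda>y. f y - c * \<bar>g y\<bar>)" using g by simp
  then show ?thesis by (simp add: f_def)
qed

section \<open>Even and odd kernels approximating powers of y\<close>

lemma one_minus_cos_le: "1 - cos x \<le> x\<^sup>2 / 2" for x :: real
proof -
  have "(sin (x / 2))\<^sup>2 \<le> (x / 2)\<^sup>2"
    by (rule abs_le_square_iff[THEN iffD1, OF abs_sin_x_le_abs_x])
  moreover have "1 - cos x = 2 * (sin (x / 2))\<^sup>2" using cos_double_sin[of "x / 2"] by simp
  ultimately show ?thesis by (simp add: power_divide)
qed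

text \<open>Substitution z = h x, which approaches 0 from the right because x > 0. Negative x is
  reached below through the parity of the kernels.\<close>

lemma tendsto_rescale_at_right_0:
  fixes k :: "real \<Rightarrow> real"
  assumes "((\<lambda>z. k z / z ^ p) \<longlongrightarrow> L) (at_right 0)" and "x > 0"
  shows "((\<lambda>h. k (h * x) / h ^ p) \<longlongrightarrow> x ^ p * L) (at_right 0)"
proof -
  have "filterlim (\<lambda>h. h * x) (at_right 0) (at_right 0)" using \<open>x > 0\<close> by real_asymp
  from tendsto_mult_left[OF filterlim_compose[OF assms(1) this], of "x ^ p"] \<open>x > 0\<close>
  show ?thesis by (simp add: power_mult_distrib)
qed

lemma even_kernel_limit: "((\<lambda>h. (1 - cos (h * x)) / h\<^sup>2) \<longlongrightarrow> x\<^sup>2 / 2) (at_right 0)" for x :: real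
proof -
  have unit: "((\<lambda>z::real. (1 - cos z) / z\<^sup>2) \<longlongrightarrow> 1 / 2) (at_right 0)" by real_asymp
  have pos: "((\<lambda>h. (1 - cos (h * x)) / h\<^sup>2) \<longlongrightarrow> x\<^sup>2 / 2) (at_right 0)" if "x > 0" for x :: real
    using tendsto_rescale_at_right_0[OF unit that] by simp
  show ?thesis
  proof (cases x "0::real" rule: linorder_cases)
    case less
    then show ?thesis using pos[of "- x"] by simp
  next
    case equal
    then show ?thesis by simp
  qed (rule pos)
qed

text \<open>Closed form of the integral over 0 \<le> t \<le> 1 of 2 sin (t x) - sin (2 t x) with
  weight 1 - t. The combination itself is 2 sin (t x) (1 - cos (t x)) and oscillates in sign; the
  weighted average has the sign of x. Division by zero yields 0 at x = 0, the correct limit.\<close>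

definition odd_kernel :: "real \<Rightarrow> real" where
  "odd_kernel x = (3 / 2 * x - 2 * sin x + sin (2 * x) / 4) / x\<^sup>2"

lemma borel_measurable_odd_kernel [measurable]: "odd_kernel \<in> borel_measurable borel"
  unfolding odd_kernel_def[abs_def] by measurable

lemma odd_kernel_uminus: "odd_kernel (- x) = - odd_kernel x"
  unfolding odd_kernel_def minus_divide_left by simp

text \<open>The derivative of the numerator of \<^const>\<open>odd_kernel\<close> is \<open>(1 - cos x)\<^sup>2\<close>.\<close>

lemma odd_kernel_bounds:
  assumes "x \<ge> 0"
  shows "0 \<le> odd_kernel x" "odd_kernel x \<le> x ^ 3 / 20"
proof -
  define A :: "real \<Rightarrow> real" where "A x = 3 / 2 * x - 2 * sin x + sin (2 * x) / 4" for x
  have dA: "(A has_real_derivative (1 - cos x)\<^sup>2) (at x)" for x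
  proof -
    have "(A has_real_derivative 3 / 2 - 2 * cos x + cos (2 * x) / 2) (at x)"
      unfolding A_def by (auto intro!: derivative_eq_intros)
    also have "3 / 2 - 2 * cos x + cos (2 * x) / 2 = (1 - cos x)\<^sup>2"
      unfolding cos_double_cos
      by (simp add: power2_eq_square algebra_simps add_divide_distrib diff_divide_distrib)
    finally show ?thesis .
  qed
  have "A 0 \<le> A x" by (rule DERIV_nonneg_imp_nondecreasing[OF assms]) (use dA zero_le_power2 in blast)
  then have A0: "0 \<le> A x" by (simp add: A_def)
  then show "0 \<le> odd_kernel x" by (simp add: odd_kernel_def A_def)
  \<comment> \<open>The comparison function x^5 / 20 has derivative x^4 / 4, the square of the bound
    x^2 / 2 for 1 - cos x.\<close>
  have "0 ^ 5 / 20 - A 0 \<le> x ^ 5 / 20 - A x"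
  proof (rule DERIV_nonneg_imp_nondecreasing[OF assms])
    fix t :: real assume "0 \<le> t"
    have "0 \<le> 1 - cos t" by simp
    moreover have "1 - cos t \<le> t\<^sup>2 / 2" by (rule one_minus_cos_le)
    ultimately have "(1 - cos t)\<^sup>2 \<le> (t\<^sup>2 / 2)\<^sup>2" by (intro power_mono)
    then have "0 \<le> t ^ 4 / 4 - (1 - cos t)\<^sup>2" by (simp add: power_divide power2_eq_square power4_eq_xxxx)
    moreover have "((\<lambda>x. x ^ 5 / 20 - A x) has_real_derivative t ^ 4 / 4 - (1 - cos t)\<^sup>2) (at t)"
      by (auto intro!: derivative_eq_intros dA)
    ultimately show "\<exists>y. ((\<lambda>x. x ^ 5 / 20 - A x) has_real_derivative y) (at t) \<and> 0 \<le> y" by blast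
  qed
  then have "A x \<le> x ^ 5 / 20" by (simp add: A_def)
  then have "A x / x\<^sup>2 \<le> (x ^ 5 / 20) / x\<^sup>2" by (rule divide_right_mono) simp
  also have "(x ^ 5 / 20) / x\<^sup>2 = x ^ 3 / 20" by (cases "x = 0") (simp_all add: eval_nat_numeral)
  finally show "odd_kernel x \<le> x ^ 3 / 20" by (simp add: odd_kernel_def A_def)
qed

lemma abs_odd_kernel_le: "\<bar>odd_kernel x\<bar> \<le> \<bar>x\<bar> ^ 3 / 20"
  using odd_kernel_bounds[of x] odd_kernel_bounds[of "- x"]
  by (cases "x \<ge> 0") (auto simp: odd_kernel_uminus)

lemma odd_kernel_integral:
  "(LBINT t. ((1 - t) * (2 * sin (t * x) - sin (2 * (t * x)))) * indicator {0..1} t) = odd_kernel x"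
proof (cases "x = 0")
  case False
  \<comment> \<open>A primitive found by one integration by parts, with 1 - t as the differentiated
    factor.\<close>
  define Q where "Q t = - (1 - t) * (2 * cos (t * x) / x - cos (2 * (t * x)) / (2 * x))
      - (2 * sin (t * x) / x\<^sup>2 - sin (2 * (t * x)) / (4 * x\<^sup>2))" for t
  have "(LBINT t. ((1 - t) * (2 * sin (t * x) - sin (2 * (t * x)))) * indicator {0..1} t) = Q 1 - Q 0"
  proof (rule integral_FTC_Icc_real)
    show "DERIV Q t :> (1 - t) * (2 * sin (t * x) - sin (2 * (t * x)))" for t
      unfolding Q_def using False
      by (auto intro!: derivative_eq_intros simp: field_simps power2_eq_square)
  qed (auto intro!: continuous_intros)
  also have "Q 1 - Q 0 = odd_kernel x"
    using False by (simp add: Q_def odd_kernel_def field_simps power2_eq_square)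
  finally show ?thesis .
qed (simp add: odd_kernel_def)

lemma odd_kernel_limit: "((\<lambda>h. odd_kernel (h * x) / h ^ 3) \<longlongrightarrow> x ^ 3 / 20) (at_right 0)"
proof -
  have unit: "((\<lambda>z. odd_kernel z / z ^ 3) \<longlongrightarrow> 1 / 20) (at_right 0)"
    unfolding odd_kernel_def by real_asymp
  have pos: "((\<lambda>h. odd_kernel (h * x) / h ^ 3) \<longlongrightarrow> x ^ 3 / 20) (at_right 0)" if "x > 0" for x
    using tendsto_rescale_at_right_0[OF unit that] by simp
  show ?thesis
  proof (cases x "0::real" rule: linorder_cases)
    case less
    then show ?thesis using tendsto_minus[OF pos[of "- x"]] by (simp add: odd_kernel_uminus)
  next
    case equal
    then show ?thesis by (simp add: odd_kernel_def)
  qed (rule pos)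
qed

text \<open>Fubini's theorem, the double integrand being dominated by 3 |g y| for 0 \<le> t \<le> 1.
  It reduces the odd kernel to the sine differences that an analytic transform controls.\<close>

lemma odd_kernel_transform:
  fixes g :: "real \<Rightarrow> real" and h :: real
  assumes g: "integrable lborel g"
  defines "\<Phi> \<equiv> \<lambda>t. ((1 - t) * indicator {0..1} t) * (LBINT y. g y * (2 * sin (t * h * y) - sin (2 * (t * h * y))))"
  shows "integrable lborel (\<lambda>y. g y * odd_kernel (h * y))"
    and "integrable lborel \<Phi>"
    and "(LBINT y. g y * odd_kernel (h * y)) = (LBINT t. \<Phi> t)"
proof -
  define k where "k t x = ((1 - t) * (2 * sin (t * x) - sin (2 * (t * x)))) * indicator {0..1} t" for t x :: real
  have g_meas [measurable]: "g \<in> borel_measurable borel" using g by simp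
  have k_meas: "(\<lambda>(y, t). g y * k t (h * y)) \<in> borel_measurable (lborel \<Otimes>\<^sub>M lborel)"
    unfolding k_def by measurable
  have k_bound: "\<bar>k t x\<bar> \<le> 3 * indicator {0..1} t" for t x
  proof (cases "t \<in> {0..1}")
    case True
    have "\<bar>2 * sin (t * x) - sin (2 * (t * x))\<bar> \<le> 3"
      using abs_sin_le_one[of "t * x"] abs_sin_le_one[of "2 * (t * x)"] by linarith
    then have "\<bar>1 - t\<bar> * \<bar>2 * sin (t * x) - sin (2 * (t * x))\<bar> \<le> 1 * 3"
      using True by (intro mult_mono) auto
    then show ?thesis using True by (simp add: k_def abs_mult)
  qed (simp add: k_def)
  have dom: "integrable (lborel \<Otimes>\<^sub>M lborel) (\<lambda>(y, t). g y * (3 * indicator {0..1::real} t))"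
  proof (rule lborel_pair.Fubini_integrable)
    show "(\<lambda>(y, t). g y * (3 * indicator {0..1::real} t)) \<in> borel_measurable (lborel \<Otimes>\<^sub>M lborel)"
      by measurable
    have "integrable lborel (\<lambda>y. \<bar>g y\<bar> * 3)" using g by simp
    then show "integrable lborel (\<lambda>y. LBINT t. norm (case (y, t) of (y, t) \<Rightarrow> g y * (3 * indicator {0..1::real} t)))"
      by (simp add: abs_mult)
  qed (auto intro!: integrable_mult_right)
  have int: "integrable (lborel \<Otimes>\<^sub>M lborel) (\<lambda>(y, t). g y * k t (h * y))"
  proof (rule Bochner_Integration.integrable_bound[OF dom k_meas], rule AE_I2)
    fix p :: "real \<times> real"
    show "norm (case p of (y, t) \<Rightarrow> g y * k t (h * y)) \<le> norm (case p of (y, t) \<Rightarrow> g y * (3 * indicator {0..1} t))"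
      using mult_left_mono[OF k_bound[of "snd p" "h * fst p"] abs_ge_zero[of "g (fst p)"]]
      by (simp add: case_prod_beta abs_mult)
  qed
  have inner_t: "(LBINT t. k t x) = odd_kernel x" for x
    using odd_kernel_integral[of x] by (simp add: k_def)
  have inner_y: "(LBINT y. g y * k t (h * y)) = \<Phi> t" for t
  proof -
    have "(\<lambda>y. g y * k t (h * y)) = (\<lambda>y. ((1 - t) * indicator {0..1} t) *
        (g y * (2 * sin (t * h * y) - sin (2 * (t * h * y)))))"
      by (simp add: k_def fun_eq_iff mult_ac)
    then show ?thesis unfolding \<Phi>_def by simp
  qed
  show "integrable lborel (\<lambda>y. g y * odd_kernel (h * y))"
    using lborel_pair.integrable_fst[OF int] by (simp add: inner_t)
  show "integrable lborel \<Phi>"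
    using lborel_pair.integrable_snd[OF int] by (simp add: inner_y)
  show "(LBINT y. g y * odd_kernel (h * y)) = (LBINT t. \<Phi> t)"
    using lborel_pair.Fubini_integral[OF int] by (simp add: inner_t inner_y)
qed

text \<open>Analyticity at 0 bounds the integrals against kernels of step \<open>\<eta> n\<close>,
  whose limits are multiples of y^2 or y^3. The even kernel serves equal signs at both ends, the odd
  one opposite signs.\<close>

proposition integrable_second_moment:
  fixes g :: "real \<Rightarrow> real"
  assumes g: "integrable lborel g" and F: "F holomorphic_on ball 0 c" "c > 0"
    and Fg: "\<And>x::real. F (of_real x) = fourier g (of_real x)"
    and s: "s \<in> {-1, 1}" "\<And>y. y > R \<Longrightarrow> 0 \<le> s * g y"
    and t: "t \<in> {-1, 1}" "\<And>y. y < - R \<Longrightarrow> 0 \<le> t * g y"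
  shows "integrable lborel (\<lambda>y. y\<^sup>2 * g y)"
proof -
  obtain B d where B: "B \<ge> 0" and d: "d > 0"
    and cos_bound: "\<And>h. 0 \<le> h \<Longrightarrow> h \<le> d \<Longrightarrow> \<bar>LBINT y. g y * (1 - cos (h * y))\<bar> \<le> B * h\<^sup>2"
    and sin_bound: "\<And>h. 0 \<le> h \<Longrightarrow> h \<le> d \<Longrightarrow>
      \<bar>LBINT y. g y * (2 * sin (h * y) - sin (2 * (h * y)))\<bar> \<le> B * h ^ 3"
    by (rule holomorphic_transform_differences[OF g F Fg]) (rule that; assumption)
  \<comment> \<open>With a nonnegative threshold, |y| > R' implies y > R or y < - R even when
    \<open>R\<close> is negative.\<close>
  define R' where "R' = max R 0"
  define \<eta> where "\<eta> n = d / real (Suc n)" for n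
  have \<eta>: "\<eta> n > 0" "\<eta> n \<le> d" for n
    using d by (simp_all add: \<eta>_def divide_le_eq mult_le_cancel_left1)
  have \<eta>_lim: "filterlim \<eta> (at_right 0) sequentially"
    unfolding \<eta>_def using d by real_asymp
  have ss: "s * s = 1" "\<bar>s\<bar> = 1" using s(1) by auto
  show ?thesis
  proof (cases "s = t")
    case True
    \<comment> \<open>The factor \<open>s\<close> makes the product of \<open>g\<close> with the
      nonnegative even kernel nonnegative on both outer half-lines.\<close>
    have "integrable lborel (\<lambda>y. g y * (s * (y\<^sup>2 / 2)))"
    proof (rule integrable_kernel_limit[where \<kappa>' = "\<lambda>n y. s * ((1 - cos (\<eta> n * y)) / (\<eta> n)\<^sup>2)"
          and R = R' and c = "R'\<^sup>2 / 2" and B = B])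
      fix n
      show "integrable lborel (\<lambda>y. g y * (s * ((1 - cos (\<eta> n * y)) / (\<eta> n)\<^sup>2)))"
      proof (rule integrable_mult_bounded[OF g, where c = "2 / (\<eta> n)\<^sup>2"])
        show "(\<lambda>y. s * ((1 - cos (\<eta> n * y)) / (\<eta> n)\<^sup>2)) \<in> borel_measurable borel" by measurable
        show "\<bar>s * ((1 - cos (\<eta> n * y)) / (\<eta> n)\<^sup>2)\<bar> \<le> 2 / (\<eta> n)\<^sup>2" for y
          unfolding abs_mult ss abs_divide using cos_ge_minus_one[of "\<eta> n * y"]
          by (simp add: divide_right_mono)
      qed
      have "(LBINT y. g y * (s * ((1 - cos (\<eta> n * y)) / (\<eta> n)\<^sup>2)))
          = (LBINT y. s / (\<eta> n)\<^sup>2 * (g y * (1 - cos (\<eta> n * y))))"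
        by (simp add: mult_ac)
      also have "\<dots> = s / (\<eta> n)\<^sup>2 * (LBINT y. g y * (1 - cos (\<eta> n * y)))" by simp
      also have "\<dots> \<le> \<bar>\<dots>\<bar>" by (rule abs_ge_self)
      also have "\<dots> = \<bar>LBINT y. g y * (1 - cos (\<eta> n * y))\<bar> / (\<eta> n)\<^sup>2"
        by (simp add: abs_mult ss)
      also have "\<dots> \<le> B" using cos_bound[of "\<eta> n"] \<eta>[of n] by (simp add: divide_le_eq)
      finally show "(LBINT y. g y * (s * ((1 - cos (\<eta> n * y)) / (\<eta> n)\<^sup>2))) \<le> B" .
    next
      fix n and y :: real assume y: "\<bar>y\<bar> \<le> R'"
      have "\<bar>s * ((1 - cos (\<eta> n * y)) / (\<eta> n)\<^sup>2)\<bar> = (1 - cos (\<eta> n * y)) / (\<eta> n)\<^sup>2"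
        by (simp add: abs_mult ss)
      also have "\<dots> \<le> ((\<eta> n * y)\<^sup>2 / 2) / (\<eta> n)\<^sup>2"
        by (intro divide_right_mono one_minus_cos_le) simp
      also have "\<dots> = \<bar>y\<bar>\<^sup>2 / 2" using \<eta>[of n] by (simp add: power_mult_distrib)
      also have "\<dots> \<le> R'\<^sup>2 / 2" using y by (intro divide_right_mono power_mono) auto
      finally show "\<bar>s * ((1 - cos (\<eta> n * y)) / (\<eta> n)\<^sup>2)\<bar> \<le> R'\<^sup>2 / 2" .
    next
      fix n and y :: real assume "\<bar>y\<bar> > R'"
      then have "0 \<le> s * g y" using s(2)[of y] t(2)[of y] True by (auto simp: R'_def abs_if split: if_splits)
      moreover have "0 \<le> (1 - cos (\<eta> n * y)) / (\<eta> n)\<^sup>2" by simp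
      ultimately have "0 \<le> (s * g y) * ((1 - cos (\<eta> n * y)) / (\<eta> n)\<^sup>2)" by (rule mult_nonneg_nonneg)
      then show "0 \<le> g y * (s * ((1 - cos (\<eta> n * y)) / (\<eta> n)\<^sup>2))" by (simp only: mult_ac)
    next
      fix y :: real
      show "(\<lambda>n. s * ((1 - cos (\<eta> n * y)) / (\<eta> n)\<^sup>2)) \<longlonglongrightarrow> s * (y\<^sup>2 / 2)"
        by (intro tendsto_mult_left filterlim_compose[OF even_kernel_limit \<eta>_lim])
    qed (simp_all add: g)
    then have "integrable lborel (\<lambda>y. 2 * s * (g y * (s * (y\<^sup>2 / 2))))"
      by (intro integrable_mult_right)
    moreover have "2 * s * (g y * (s * (y\<^sup>2 / 2))) = y\<^sup>2 * g y" for y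
    proof -
      have "2 * s * (g y * (s * (y\<^sup>2 / 2))) = (s * s) * (y\<^sup>2 * g y)" by simp
      then show ?thesis by (simp only: ss mult_1)
    qed
    ultimately show ?thesis by (simp only:)
  next
    case False
    \<comment> \<open>Opposite signs are matched by the odd kernel, which yields even the third
      moment.\<close>
    with s(1) t(1) have ts: "t = - s" by auto
    have "integrable lborel (\<lambda>y. g y * (s * (y ^ 3 / 20)))"
    proof (rule integrable_kernel_limit[where \<kappa>' = "\<lambda>n y. s * (odd_kernel (\<eta> n * y) / (\<eta> n) ^ 3)"
          and R = R' and c = "R' ^ 3 / 20" and B = B])
      fix n
      note tr = odd_kernel_transform[OF g, of "\<eta> n"]
      have "integrable lborel (\<lambda>y. s / (\<eta> n) ^ 3 * (g y * odd_kernel (\<eta> n * y)))" using tr(1) by simp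
      then show "integrable lborel (\<lambda>y. g y * (s * (odd_kernel (\<eta> n * y) / (\<eta> n) ^ 3)))"
        by (simp add: mult_ac)
      let ?\<Phi> = "\<lambda>t. (1 - t) * indicator {0..1} t * (LBINT y. g y * (2 * sin (t * \<eta> n * y) - sin (2 * (t * \<eta> n * y))))"
      have "\<bar>LBINT y. g y * odd_kernel (\<eta> n * y)\<bar> \<le> (LBINT t. \<bar>?\<Phi> t\<bar>)"
        unfolding tr(3) by (rule integral_abs_bound)
      also have "\<dots> \<le> (LBINT t. B * (\<eta> n) ^ 3 * indicator {0..1::real} t)"
      proof (rule integral_mono)
        fix t :: real
        let ?I = "LBINT y. g y * (2 * sin (t * \<eta> n * y) - sin (2 * (t * \<eta> n * y)))"
        show "\<bar>(1 - t) * indicator {0..1} t * ?I\<bar> \<le> B * (\<eta> n) ^ 3 * indicator {0..1} t"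
        proof (cases "t \<in> {0..1}")
          case True
          \<comment> \<open>Scaling by t in [0, 1] keeps the step at most \<open>d\<close>, so the
            cubic bound holds uniformly in t.\<close>
          then have th: "0 \<le> t * \<eta> n" "t * \<eta> n \<le> \<eta> n"
            using \<eta>[of n] by (simp_all add: mult_left_le_one_le)
          then have "\<bar>?I\<bar> \<le> B * (t * \<eta> n) ^ 3" using sin_bound[of "t * \<eta> n"] \<eta>[of n] by linarith
          also have "\<dots> \<le> B * (\<eta> n) ^ 3" using th B by (intro mult_left_mono power_mono) auto
          finally have "\<bar>1 - t\<bar> * \<bar>?I\<bar> \<le> 1 * (B * (\<eta> n) ^ 3)"
            using True by (intro mult_mono) auto
          then show ?thesis using True by (simp add: abs_mult)
        qed simp
      next
        show "integrable lborel (\<lambda>t. \<bar>?\<Phi> t\<bar>)" using tr(2) by (rule integrable_abs)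
      qed (auto intro!: integrable_mult_right)
      also have "\<dots> = B * (\<eta> n) ^ 3" by simp
      finally have b: "\<bar>LBINT y. g y * odd_kernel (\<eta> n * y)\<bar> \<le> B * (\<eta> n) ^ 3" .
      have "(LBINT y. g y * (s * (odd_kernel (\<eta> n * y) / (\<eta> n) ^ 3)))
          = (LBINT y. s / (\<eta> n) ^ 3 * (g y * odd_kernel (\<eta> n * y)))"
        by (simp add: mult_ac)
      also have "\<dots> = s / (\<eta> n) ^ 3 * (LBINT y. g y * odd_kernel (\<eta> n * y))" by simp
      also have "\<dots> \<le> \<bar>\<dots>\<bar>" by (rule abs_ge_self)
      also have "\<dots> = \<bar>LBINT y. g y * odd_kernel (\<eta> n * y)\<bar> / (\<eta> n) ^ 3"
        using \<eta>[of n] by (simp add: abs_mult ss)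
      also have "\<dots> \<le> B" using b \<eta>[of n] by (simp add: divide_le_eq)
      finally show "(LBINT y. g y * (s * (odd_kernel (\<eta> n * y) / (\<eta> n) ^ 3))) \<le> B" .
    next
      fix n and y :: real assume y: "\<bar>y\<bar> \<le> R'"
      have "\<bar>s * (odd_kernel (\<eta> n * y) / (\<eta> n) ^ 3)\<bar> = \<bar>odd_kernel (\<eta> n * y)\<bar> / (\<eta> n) ^ 3"
        using \<eta>[of n] by (simp add: abs_mult ss)
      also have "\<dots> \<le> (\<bar>\<eta> n * y\<bar> ^ 3 / 20) / (\<eta> n) ^ 3"
        using \<eta>[of n] by (intro divide_right_mono abs_odd_kernel_le) simp
      also have "\<dots> = \<bar>y\<bar> ^ 3 / 20" using \<eta>[of n] by (simp add: power_mult_distrib abs_mult)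
      also have "\<dots> \<le> R' ^ 3 / 20" using y by (intro divide_right_mono power_mono) auto
      finally show "\<bar>s * (odd_kernel (\<eta> n * y) / (\<eta> n) ^ 3)\<bar> \<le> R' ^ 3 / 20" .
    next
      fix n and y :: real assume y: "\<bar>y\<bar> > R'"
      have "0 \<le> (s * g y) * (odd_kernel (\<eta> n * y) / (\<eta> n) ^ 3)"
      proof (cases "y \<ge> 0")
        case True
        then have "0 \<le> odd_kernel (\<eta> n * y) / (\<eta> n) ^ 3"
          using \<eta>[of n] by (intro divide_nonneg_nonneg odd_kernel_bounds) auto
        moreover have "0 \<le> s * g y" using True y s(2)[of y] by (simp add: R'_def)
        ultimately show ?thesis by (intro mult_nonneg_nonneg[of "s * g y"])
      next
        case False
        \<comment> \<open>For negative y the minus sign from oddness cancels the one in t = -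
          s.\<close>
        then have "0 \<le> odd_kernel (\<eta> n * (- y)) / (\<eta> n) ^ 3"
          using \<eta>[of n] by (intro divide_nonneg_nonneg odd_kernel_bounds) (auto simp: mult_nonneg_nonpos)
        moreover have "0 \<le> t * g y" using False y t(2)[of y] by (simp add: R'_def)
        ultimately have "0 \<le> (t * g y) * (odd_kernel (\<eta> n * (- y)) / (\<eta> n) ^ 3)"
          by (intro mult_nonneg_nonneg[of "t * g y"])
        then show ?thesis by (simp add: ts odd_kernel_uminus)
      qed
      then show "0 \<le> g y * (s * (odd_kernel (\<eta> n * y) / (\<eta> n) ^ 3))" by (simp only: mult_ac)
    next
      fix y :: real
      show "(\<lambda>n. s * (odd_kernel (\<eta> n * y) / (\<eta> n) ^ 3)) \<longlonglongrightarrow> s * (y ^ 3 / 20)"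
        by (intro tendsto_mult_left filterlim_compose[OF odd_kernel_limit \<eta>_lim])
    next
      show "0 \<le> R' ^ 3 / 20" by (simp add: R'_def)
    qed (simp_all add: g)
    then have "integrable lborel (\<lambda>y. 20 * s * (g y * (s * (y ^ 3 / 20))))"
      by (intro integrable_mult_right)
    moreover have "20 * s * (g y * (s * (y ^ 3 / 20))) = y ^ 3 * g y" for y
    proof -
      have "20 * s * (g y * (s * (y ^ 3 / 20))) = (s * s) * (y ^ 3 * g y)" by simp
      then show ?thesis by (simp only: ss mult_1)
    qed
    ultimately have "integrable lborel (\<lambda>y. y ^ 3 * g y)" by (simp only:)
    then show ?thesis by (rule integrable_lower_moment[OF g]) simp
  qed
qed

section \<open>The coefficients of the payoff and the tail bounds\<close>

text \<open>If some critical component is unbounded above, it contains a half-line on which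
  \<open>P\<close> is constant. Otherwise the critical set is bounded above, Rolle's theorem makes
  \<open>P\<close> injective further out, and an injective continuous function keeps its sign beyond
  its only possible zero.\<close>

lemma eventually_one_sign:
  fixes P :: "real \<Rightarrow> real"
  assumes S: "finite S" "\<And>x. x \<notin> S \<Longrightarrow> P differentiable at x"
    and \<C>: "finite \<C>" "\<And>c. c \<in> \<C> \<Longrightarrow> connected c"
    and crit: "{x. (P has_real_derivative 0) (at x)} = \<Union>\<C>"
  obtains s R :: real where "s \<in> {-1, 1}" "\<And>y. y > R \<Longrightarrow> 0 \<le> s * P y"
proof -
  obtain r where r: "\<And>x. x \<in> S \<Longrightarrow> x \<le> r"
    using bdd_above_finite[OF S(1)] by (auto simp: bdd_above_def)
  have diff: "P differentiable at x" if "x > r" for x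
    using S(2)[of x] r[of x] that by force
  have cont: "continuous_on A P" if "A \<subseteq> {r<..}" for A
    using that diff by (intro continuous_at_imp_continuous_on ballI differentiable_imp_continuous_within) auto
  show ?thesis
  proof (cases "\<exists>c\<in>\<C>. \<not> bdd_above c")
    case True
    then obtain c where c: "c \<in> \<C>" "\<not> bdd_above c" by metis
    have unb: "\<exists>x\<in>c. x > M" for M
      using c(2) by (meson bdd_aboveI linorder_not_le)
    obtain x where x: "x \<in> c" "x > r" using unb by blast
    \<comment> \<open>A connected set unbounded above contains everything to the right of each of
      its points.\<close>
    have in_c: "y \<in> c" if "y \<ge> x" for y
    proof -
      obtain z where "z \<in> c" "z > y" using unb by blast
      then show ?thesis
        using connectedD_interval[OF \<C>(2)[OF c(1)] x(1), of z y] that by simp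
    qed
    have "(P has_real_derivative 0) (at y within {x..})" if "y \<in> {x..}" for y
    proof -
      have "y \<in> c" using in_c that by simp
      have "y \<in> {x. (P has_real_derivative 0) (at x)}"
        unfolding crit using c(1) \<open>y \<in> c\<close> by (rule UnionI)
      then show ?thesis by (simp add: has_field_derivative_at_within)
    qed
    then obtain k where "\<forall>y\<in>{x..}. P y = k"
      using has_field_derivative_zero_constant[of "{x..}" P] by auto
    then show ?thesis
      by (intro that[of "if k \<ge> 0 then 1 else -1" x]) auto
  next
    case False
    then have "bdd_above (\<Union>\<C>)" using bdd_above_UN[OF \<C>(1), of id] by simp
    then obtain q where q: "\<And>x. (P has_real_derivative 0) (at x) \<Longrightarrow> x \<le> q"
      unfolding bdd_above_def crit[symmetric] by blast
    define R where "R = max q r"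
    have inj: "P x \<noteq> P y" if xy: "R < x" "x < y" for x y
    proof
      assume "P x = P y"
      then obtain z where "x < z" "(P has_real_derivative 0) (at z)"
        using Rolle[OF xy(2), of P] cont[of "{x..y}"] diff xy(1) by (force simp: R_def)
      with q[of z] xy show False by (simp add: R_def)
    qed
    \<comment> \<open>By injectivity there is at most one zero beyond \<open>R\<close>; the
      threshold is moved there.\<close>
    obtain R' where R': "R' \<ge> R" "\<And>y. y > R' \<Longrightarrow> P y \<noteq> 0"
    proof (cases "\<exists>z>R. P z = 0")
      case True
      then obtain z where "z > R" "P z = 0" by blast
      then show ?thesis using inj[of z] by (intro that[of z]) auto
    next
      case False
      then show ?thesis by (intro that[of R]) auto
    qed
    have "connected (P ` {R'<..})"
      using R'(1) by (intro connected_continuous_image cont) (auto simp: R_def)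
    have "(\<forall>y>R'. P y \<ge> 0) \<or> (\<forall>y>R'. P y \<le> 0)"
    proof (rule ccontr)
      assume "\<not> ?thesis"
      then obtain x y where "x > R'" "P x < 0" "y > R'" "P y > 0" by (auto simp: not_le)
      then have "0 \<in> P ` {R'<..}"
        using connectedD_interval[OF \<open>connected (P ` {R'<..})\<close>, of "P x" "P y" 0] by auto
      with R'(2) show False by auto
    qed
    then show ?thesis
      using that[of 1 R'] that[of "-1" R'] by auto
  qed
qed

text \<open>The left end of \<open>P\<close> is the right end of its mirror image, whose critical
  set is reflected; reflection keeps the components connected and finite in number.\<close>

lemma eventually_one_sign_both_ends:
  fixes P :: "real \<Rightarrow> real"
  assumes "piecewise_C1 P" "finitely_many_critical P"
  obtains s t R :: real where "s \<in> {-1, 1}" "\<And>y. y > R \<Longrightarrow> 0 \<le> s * P y"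
    "t \<in> {-1, 1}" "\<And>y. y < - R \<Longrightarrow> 0 \<le> t * P y"
proof -
  define T where "T = {x. (P has_real_derivative 0) (at x)}"
  define Q where "Q y = P (- y)" for y
  obtain S where S: "finite S" "P C1_differentiable_on (- S)"
    using assms(1) by (auto simp: piecewise_C1_def)
  have diff: "P differentiable at x" if "x \<notin> S" for x
    using S(2) that by (auto simp: C1_differentiable_on_eq)
  have fin: "finite (components T)" using assms(2) by (simp add: finitely_many_critical_def T_def)
  obtain s R\<^sub>1 where s: "s \<in> {-1, 1}" "\<And>y. y > R\<^sub>1 \<Longrightarrow> 0 \<le> s * P y"
  proof (rule eventually_one_sign[OF S(1) diff fin])
    show "{x. (P has_real_derivative 0) (at x)} = \<Union> (components T)"
      by (simp add: T_def)
  qed (auto simp: in_components_connected)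
  have Q_deriv: "(Q has_real_derivative D) (at x) \<longleftrightarrow> (P has_real_derivative - D) (at (- x))" for D x
    unfolding Q_def using DERIV_mirror[of P "- D" x] by simp
  obtain t R\<^sub>2 where t: "t \<in> {-1, 1}" "\<And>y. y > R\<^sub>2 \<Longrightarrow> 0 \<le> t * Q y"
  proof (rule eventually_one_sign[of "uminus ` S" Q "(`) uminus ` components T"])
    show "Q differentiable at x" if "x \<notin> uminus ` S" for x
    proof -
      have "- x \<notin> S" using that by (metis add.inverse_inverse imageI)
      then obtain D where "(P has_real_derivative - D) (at (- x))"
        using diff by (metis add.inverse_inverse real_differentiable_def)
      then show ?thesis unfolding real_differentiable_def Q_deriv by blast
    qed
    show "connected c" if "c \<in> (`) uminus ` components T" for c
    proof -
      from that obtain c' where c': "c' \<in> components T" "c = uminus ` c'" by blast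
      show ?thesis unfolding c'(2)
        by (intro connected_continuous_image continuous_intros in_components_connected[OF c'(1)])
    qed
    have "\<Union> ((`) uminus ` components T) = uminus ` T"
      by (simp flip: image_Union)
    then show "{x. (Q has_real_derivative 0) (at x)} = \<Union> ((`) uminus ` components T)"
      by (force simp: Q_deriv T_def)
  qed (use S(1) fin in auto)
  show ?thesis
  proof (rule that[of s "max R\<^sub>1 R\<^sub>2" t])
    show "0 \<le> t * P y" if "y < - max R\<^sub>1 R\<^sub>2" for y
      using t(2)[of "- y"] that by (simp add: Q_def)
  qed (use s t in auto)
qed

text \<open>The cuts run vertically away from the real axis, so |Im| on the cut from b is at least
  |Im b|, while |Im z| \<le> |z| < c in the ball.\<close>

lemma ball_subset_slit_plane:
  assumes "\<And>b. b \<in> B \<Longrightarrow> c \<le> \<bar>Im b\<bar>"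
  shows "ball 0 c \<subseteq> slit_plane B"
proof
  fix z :: complex assume "z \<in> ball 0 c"
  then have z: "\<bar>Im z\<bar> < c" using abs_Im_le_cmod[of z] by simp
  show "z \<in> slit_plane B"
  proof (rule ccontr)
    assume "z \<notin> slit_plane B"
    then obtain b where b: "b \<in> B" "z \<in> insert b (branch_cut b)" by (auto simp: slit_plane_def)
    have "\<bar>Im b\<bar> \<le> \<bar>Im z\<bar>"
      using b(2) by (auto simp: branch_cut_def ray_def sgn_cut_def)
    with assms[OF b(1)] z show False by simp
  qed
qed

text \<open>All branch points lie at distance at least min a_h b_h from the real axis, so the ball
  of that radius about 0 avoids every cut, and each factor of \<open>Z\<close>, as well as
  \<open>H\<close>, is holomorphic there.\<close>

lemma assumption_A_imp_holomorphic_near_0: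
  assumes "assumption_A h a\<^sub>h b\<^sub>h \<gamma>\<^sub>p \<gamma>\<^sub>m"
  obtains c F where "c > 0" "F holomorphic_on ball 0 c"
    "\<And>x::real. F (of_real x) = fourier h (of_real x)"
proof -
  obtain B \<rho> Lg Z H F where pos: "a\<^sub>h > 0" "b\<^sub>h > 0" "finite B"
    and B: "\<forall>b\<in>B. Im b \<noteq> 0 \<and> \<rho> b \<noteq> 0 \<and> log_branch b (Lg b)"
    and H: "H holomorphic_on UNIV" and Z: "has_branch_points Z B \<rho> Lg"
    and F: "\<forall>u\<in>slit_plane B. F u = Z u + H u"
    and Fh: "\<forall>x::real. F (of_real x) = fourier h (of_real x)"
    and up: "\<forall>b\<in>B. Im b > 0 \<longrightarrow> Im b \<ge> b\<^sub>h" and low: "\<forall>b\<in>B. Im b < 0 \<longrightarrow> Im b \<le> - a\<^sub>h"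
    using assms unfolding assumption_A_def by blast
  obtain B\<^sub>a B\<^sub>l g where Bal: "B = B\<^sub>a \<union> B\<^sub>l" and g: "g holomorphic_on slit_plane B\<^sub>l"
    and Zg: "\<forall>u\<in>slit_plane B. Z u = g u * (\<Prod>b\<in>B\<^sub>a. exp (- \<rho> b * Lg b u))"
    using Z unfolding has_branch_points_def by blast
  define c where "c = min a\<^sub>h b\<^sub>h"
  have c: "c > 0" using pos by (simp add: c_def)
  have far: "c \<le> \<bar>Im b\<bar>" if "b \<in> B" for b
    using that B up low by (cases "Im b" "0::real" rule: linorder_cases) (force simp: c_def)+
  have sub: "ball 0 c \<subseteq> slit_plane A" if "A \<subseteq> B" for A
    using that far by (intro ball_subset_slit_plane) auto
  have "(\<lambda>u. exp (- \<rho> b * Lg b u)) holomorphic_on ball 0 c" if "b \<in> B\<^sub>a" for b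
  proof -
    have "b \<in> B" using that Bal by simp
    then have "Lg b holomorphic_on ball 0 c"
      using B sub[of "{b}"] by (auto simp: log_branch_def intro: holomorphic_on_subset)
    then show ?thesis by (intro holomorphic_intros)
  qed
  moreover have "g holomorphic_on ball 0 c" using g sub[of B\<^sub>l] Bal by (auto intro: holomorphic_on_subset)
  moreover have "H holomorphic_on ball 0 c" using H by (rule holomorphic_on_subset) simp
  ultimately have "(\<lambda>u. g u * (\<Prod>b\<in>B\<^sub>a. exp (- \<rho> b * Lg b u)) + H u) holomorphic_on ball 0 c"
    by (intro holomorphic_on_add holomorphic_on_mult holomorphic_on_prod)
  then have "F holomorphic_on ball 0 c"
    by (rule holomorphic_transform) (use F Zg sub[of B] in auto)
  with c Fh show ?thesis by (intro that[of c F]) auto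
qed

text \<open>The shift of the argument contributes exp (- \<alpha> y), which is the damping
  factor.\<close>

lemma fourier_damp_payoff:
  "fourier P (z - \<i> * of_real \<alpha>) = fourier (damp_payoff \<alpha> P) z"
proof -
  have "of_real (P y) * exp (- \<i> * (z - \<i> * of_real \<alpha>) * of_real y)
      = of_real (damp_payoff \<alpha> P y) * exp (- \<i> * z * of_real y)" for y :: real
  proof -
    have eq: "- \<i> * (z - \<i> * of_real \<alpha>) * of_real y = of_real (- \<alpha> * y) + - \<i> * z * of_real y"
      by (simp add: algebra_simps)
    show ?thesis unfolding eq exp_add exp_of_real damp_payoff_def by simp
  qed
  then show ?thesis unfolding fourier_def by simp
qed

text \<open>Damping multiplies by a positive factor, so the damped payoff inherits the eventual
  signs of \<open>P\<close>. Together with analyticity near 0 this gives the second moment that the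
  sinc estimate requires.\<close>

proposition payoff_coefficient_decay:
  assumes S: "assumption_S f P \<alpha>" and A: "assumption_A (damp_payoff \<alpha> P) a' b' \<gamma>\<^sub>p' \<gamma>\<^sub>m'"
  obtains K where "\<And>k. grid m k \<noteq> 0 \<Longrightarrow> \<bar>V_coeff m \<alpha> P k\<bar> \<le>
     2 powr (- of_int m / 2) * (eps_V m \<alpha> P / \<bar>grid m k\<bar>) + K / (grid m k)\<^sup>2"
proof -
  define g where "g = damp_payoff \<alpha> P"
  have g: "integrable lborel g" using A by (simp add: assumption_A_def g_def)
  obtain c F where F: "c > 0" "F holomorphic_on ball 0 c"
    "\<And>x::real. F (of_real x) = fourier g (of_real x)"
    by (rule assumption_A_imp_holomorphic_near_0[OF A, folded g_def]) (rule that; assumption)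
  obtain s t R where s: "s \<in> {-1, 1}" "\<And>y. y > R \<Longrightarrow> 0 \<le> s * P y"
    and t: "t \<in> {-1, 1}" "\<And>y. y < - R \<Longrightarrow> 0 \<le> t * P y"
    using S eventually_one_sign_both_ends[of P] unfolding assumption_S_def by metis
  have "integrable lborel (\<lambda>y. y\<^sup>2 * g y)"
  proof (rule integrable_second_moment[OF g F(2,1,3) s(1) _ t(1)])
    show "0 \<le> s * g y" if "y > R" for y
      using mult_nonneg_nonneg[OF s(2)[OF that], of "exp (- \<alpha> * y)"]
      by (simp add: g_def damp_payoff_def mult_ac)
    show "0 \<le> t * g y" if "y < - R" for y
      using mult_nonneg_nonneg[OF t(2)[OF that], of "exp (- \<alpha> * y)"]
      by (simp add: g_def damp_payoff_def mult_ac)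
  qed
  from sinc_coefficient_decay[OF g this, of m]
  obtain K where K: "\<And>k. grid m k \<noteq> 0 \<Longrightarrow> \<bar>LBINT y. g y * phi m k y\<bar> \<le>
     2 powr (- of_int m / 2) * (\<bar>LBINT y. g y * sin (2 powi m * pi * y)\<bar> / pi / \<bar>grid m k\<bar>)
     + K / (grid m k)\<^sup>2" by blast
  \<comment> \<open>The shifted transform of \<open>P\<close> is that of the damped payoff at 2^m
    pi, whose imaginary part is minus the sine integral.\<close>
  have "eps_V m \<alpha> P = \<bar>LBINT y. g y * sin (2 powi m * pi * y)\<bar> / pi"
    unfolding eps_V_def fourier_damp_payoff g_def[symmetric] Im_fourier_of_real[OF g] by simp
  with K show ?thesis
    by (intro that[of K]) (simp add: V_coeff_def g_def)
qed

section \<open>Right and left truncation tails\<close>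

lemma grid_eq: "of_int k / 2 powi m = grid m k"
  by (simp add: grid_def)

lemma T_plus_bound:
  assumes "assumption_S f P \<alpha>" "assumption_A (damp_density \<alpha> f) (a + \<alpha>) (b - \<alpha>) \<gamma>\<^sub>p \<gamma>\<^sub>m"
    and "assumption_A (damp_payoff \<alpha> P) a' b' \<gamma>\<^sub>p' \<gamma>\<^sub>m'" "C\<^sub>p > 0"
    and D: "density_coeff_bound m f \<alpha> \<mu> a b \<gamma>\<^sub>p \<gamma>\<^sub>m C\<^sub>p C\<^sub>m"
  obtains K where "K \<ge> 0" "\<And>u. grid m u > max 0 (1 + \<mu>) \<Longrightarrow> T_plus m \<alpha> f P u
    \<le> ennreal (eps_D m \<alpha> f * eps_V m \<alpha> P * log_term_plus \<mu> (grid m u)) + ennreal (K / (grid m u)\<^sup>2)"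
proof -
  obtain K\<^sub>V where V: "\<And>k. grid m k \<noteq> 0 \<Longrightarrow> \<bar>V_coeff m \<alpha> P k\<bar> \<le>
     2 powr (- of_int m / 2) * (eps_V m \<alpha> P / \<bar>grid m k\<bar>) + K\<^sub>V / (grid m k)\<^sup>2"
    using payoff_coefficient_decay[OF assms(1,3)] by blast
  obtain K\<^sub>D where K\<^sub>D: "\<And>k. grid m k - \<mu> > 1 \<Longrightarrow> \<bar>D_coeff m \<alpha> f k\<bar> \<le> 2 powr (- of_int m / 2) *
      (C\<^sub>p * exp (\<alpha> * \<mu>) * (grid m k - \<mu>) powr (\<gamma>\<^sub>p - 1) * exp (- (b - \<alpha>) * (grid m k - \<mu>))
        + eps_D m \<alpha> f / (grid m k - \<mu>)) + K\<^sub>D / (grid m k - \<mu>)\<^sup>2"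
    using D unfolding density_coeff_bound_def Let_def by blast
  show ?thesis
  proof (rule coefficient_tail_bound[OF _ _ _ _ K\<^sub>D])
    show "0 \<le> C\<^sub>p * exp (\<alpha> * \<mu>)" using \<open>C\<^sub>p > 0\<close> by simp
    show "0 < b - \<alpha>" using assms(2) by (simp add: assumption_A_def)
    show "\<bar>V_coeff m \<alpha> P k\<bar> \<le> 2 powr (- of_int m / 2) * (eps_V m \<alpha> P / grid m k) + K\<^sub>V / (grid m k)\<^sup>2"
      if "grid m k > 0" for k using V[of k] that by simp
  qed (auto simp: eps_D_def eps_V_def T_plus_def intro: that)
qed

text \<open>Under reflection the argument of the logarithm becomes its reciprocal and \<mu> changes
  sign, so the two minus signs cancel.\<close>

lemma log_term_minus_eq:
  assumes "L < 0" "L < \<mu>"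
  shows "log_term_minus \<mu> L = log_term_plus (- \<mu>) (- L)"
proof (cases "\<mu> = 0")
  case False
  have "ln ((- L) / (- L + \<mu>)) = - ln ((L - \<mu>) / L)"
  proof -
    have eq: "(- L) / (- L + \<mu>) = inverse ((L - \<mu>) / L)"
      using assms by (simp add: divide_simps) (simp add: algebra_simps)
    show ?thesis unfolding eq by (rule ln_inverse)
  qed
  with False show ?thesis by (simp add: log_term_minus_def log_term_plus_def)
qed (use assms in \<open>simp add: log_term_minus_def log_term_plus_def\<close>)

text \<open>Reflecting \<open>k\<close> to \<open>- k\<close> and \<mu> to - \<mu> turns the left
  tail into a right tail with decay rate \<open>a + \<alpha>\<close>.\<close>

lemma T_minus_bound:
  assumes "assumption_S f P \<alpha>" "assumption_A (damp_density \<alpha> f) (a + \<alpha>) (b - \<alpha>) \<gamma>\<^sub>p \<gamma>\<^sub>m"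
    and "assumption_A (damp_payoff \<alpha> P) a' b' \<gamma>\<^sub>p' \<gamma>\<^sub>m'" "C\<^sub>m > 0"
    and D: "density_coeff_bound m f \<alpha> \<mu> a b \<gamma>\<^sub>p \<gamma>\<^sub>m C\<^sub>p C\<^sub>m"
  obtains K where "K \<ge> 0" "\<And>l. grid m l < min 0 (\<mu> - 1) \<Longrightarrow> T_minus m \<alpha> f P l
    \<le> ennreal (eps_D m \<alpha> f * eps_V m \<alpha> P * log_term_minus \<mu> (grid m l)) + ennreal (K / (grid m l)\<^sup>2)"
proof -
  obtain K\<^sub>V where V: "\<And>k. grid m k \<noteq> 0 \<Longrightarrow> \<bar>V_coeff m \<alpha> P k\<bar> \<le>
     2 powr (- of_int m / 2) * (eps_V m \<alpha> P / \<bar>grid m k\<bar>) + K\<^sub>V / (grid m k)\<^sup>2"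
    using payoff_coefficient_decay[OF assms(1,3)] by blast
  obtain K\<^sub>D where K\<^sub>D: "\<And>k. grid m k - \<mu> < - 1 \<Longrightarrow> \<bar>D_coeff m \<alpha> f k\<bar> \<le> 2 powr (- of_int m / 2) *
      (C\<^sub>m * exp (\<alpha> * \<mu>) * \<bar>grid m k - \<mu>\<bar> powr (\<gamma>\<^sub>m - 1) * exp (- (a + \<alpha>) * \<bar>grid m k - \<mu>\<bar>)
        + eps_D m \<alpha> f / \<bar>grid m k - \<mu>\<bar>) + K\<^sub>D / (grid m k - \<mu>)\<^sup>2"
    using D unfolding density_coeff_bound_def Let_def by blast
  have D': "\<bar>D_coeff m \<alpha> f (- k)\<bar> \<le> 2 powr (- of_int m / 2) *
      (C\<^sub>m * exp (\<alpha> * \<mu>) * (grid m k - - \<mu>) powr (\<gamma>\<^sub>m - 1) * exp (- (a + \<alpha>) * (grid m k - - \<mu>))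
        + eps_D m \<alpha> f / (grid m k - - \<mu>)) + K\<^sub>D / (grid m k - - \<mu>)\<^sup>2" if "grid m k - - \<mu> > 1" for k
  proof -
    have "\<bar>grid m (- k) - \<mu>\<bar> = grid m k - - \<mu>" "(grid m (- k) - \<mu>)\<^sup>2 = (grid m k - - \<mu>)\<^sup>2"
      "grid m (- k) - \<mu> < - 1"
      using that by (auto simp: grid_uminus power2_eq_square algebra_simps)
    with K\<^sub>D[of "- k"] show ?thesis by simp
  qed
  have V': "\<bar>V_coeff m \<alpha> P (- k)\<bar> \<le> 2 powr (- of_int m / 2) * (eps_V m \<alpha> P / grid m k) + K\<^sub>V / (grid m k)\<^sup>2"
    if "grid m k > 0" for k using V[of "- k"] that by (simp add: grid_uminus)
  have C: "0 \<le> C\<^sub>m * exp (\<alpha> * \<mu>)" and \<beta>: "0 < a + \<alpha>" and "0 \<le> eps_D m \<alpha> f" "0 \<le> eps_V m \<alpha> P"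
    using \<open>C\<^sub>m > 0\<close> assms(2) by (simp_all add: assumption_A_def eps_D_def eps_V_def)
  obtain K where K: "K \<ge> 0" "\<And>u. grid m u > max 0 (1 + - \<mu>) \<Longrightarrow>
      (\<Sum>\<^sub>\<infinity>k\<in>{u<..}. ennreal \<bar>D_coeff m \<alpha> f (- k) * V_coeff m \<alpha> P (- k)\<bar>)
       \<le> ennreal (eps_D m \<alpha> f * eps_V m \<alpha> P * log_term_plus (- \<mu>) (grid m u)) + ennreal (K / (grid m u)\<^sup>2)"
    using coefficient_tail_bound[OF C \<open>0 \<le> eps_D m \<alpha> f\<close> \<open>0 \<le> eps_V m \<alpha> P\<close> \<beta> D' V'] by blast
  show ?thesis
  proof (rule that[OF K(1)])
    fix l assume l: "grid m l < min 0 (\<mu> - 1)"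
    have "T_minus m \<alpha> f P l = (\<Sum>\<^sub>\<infinity>k\<in>{- l<..}. ennreal \<bar>D_coeff m \<alpha> f (- k) * V_coeff m \<alpha> P (- k)\<bar>)"
      unfolding T_minus_def
    proof (rule infsum_reindex_bij_betw[symmetric])
      show "bij_betw uminus {- l<..} {..<l}"
        by (rule bij_betwI[of _ _ _ uminus]) auto
    qed
    also have "\<dots> \<le> ennreal (eps_D m \<alpha> f * eps_V m \<alpha> P * log_term_plus (- \<mu>) (grid m (- l)))
        + ennreal (K / (grid m (- l))\<^sup>2)"
      using l by (intro K(2)) (auto simp: grid_uminus)
    also have "log_term_plus (- \<mu>) (grid m (- l)) = log_term_minus \<mu> (grid m l)"
      using l by (simp add: grid_uminus log_term_minus_eq)
    finally show "T_minus m \<alpha> f P l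
      \<le> ennreal (eps_D m \<alpha> f * eps_V m \<alpha> P * log_term_minus \<mu> (grid m l)) + ennreal (K / (grid m l)\<^sup>2)"
      by (simp add: grid_uminus)
  qed
qed

text \<open>Every \<open>ennreal\<close> is nonnegative, so a bound by the logarithmic term
  \<open>L\<close> and the remainder \<open>K\<close> extends to the full sum.\<close>

lemma ennreal_sum_le_extend:
  fixes T A B M L K :: ennreal
  assumes "T \<le> L + K"
  shows "T \<le> A + B + L + M + K"
proof -
  have "L + K \<le> (A + B + L + M) + K"
    by (intro add_mono order_refl) (metis add.assoc add.commute add_increasing2 le_add1 order_refl zero_le)
  with assms show ?thesis by (rule order_trans)
qed

theorem theorem4p4:
  fixes m :: int and f P :: "real \<Rightarrow> real" and \<alpha> a b \<gamma>\<^sub>p \<gamma>\<^sub>m \<mu> C\<^sub>p C\<^sub>m :: real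
  assumes "density_function f"
    and "assumption_S f P \<alpha>"
    and "assumption_A (damp_density \<alpha> f) (a + \<alpha>) (b - \<alpha>) \<gamma>\<^sub>p \<gamma>\<^sub>m"
    and "\<exists>a' b' \<gamma>\<^sub>p' \<gamma>\<^sub>m'. assumption_A (damp_payoff \<alpha> P) a' b' \<gamma>\<^sub>p' \<gamma>\<^sub>m'"
    and "assumption_B m (damp_density \<alpha> f)"
    and "assumption_B m (damp_payoff \<alpha> P)"
    and "C\<^sub>p > 0" and "C\<^sub>m > 0"
    and "density_coeff_bound m f \<alpha> \<mu> a b \<gamma>\<^sub>p \<gamma>\<^sub>m C\<^sub>p C\<^sub>m"
  shows
    "(\<exists>K\<ge>0. \<forall>(u::int) U. U = of_int u / 2 powi m \<and> U > max 0 (1 + \<mu>) \<longrightarrow>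
        T_plus m \<alpha> f P u \<le>
            ennreal (C\<^sub>p * exp (\<alpha> * \<mu>))
              * ((Linf_norm {U..} (damp_payoff \<alpha> P) + ennreal (eps_V m \<alpha> P / U))
                  / ennreal ((b - \<alpha>) powr \<gamma>\<^sub>p))
              * ennreal (upper_Gamma \<gamma>\<^sub>p ((b - \<alpha>) * (U - \<mu>)))
          + ennreal (eps_D m \<alpha> f) * L1_norm {U..} (damp_payoff \<alpha> P) * ennreal (1 / (U - \<mu>))
          + ennreal (eps_D m \<alpha> f * eps_V m \<alpha> P * log_term_plus \<mu> U)
          + ennreal (2 powi (1 - m))
              * (\<Sum>\<^sub>\<infinity>y\<in>local_maxima (G_plus m f P \<alpha> \<mu> b \<gamma>\<^sub>p C\<^sub>p) ({0<..} \<inter> {1 + \<mu><..}).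
                   ennreal (G_plus m f P \<alpha> \<mu> b \<gamma>\<^sub>p C\<^sub>p y * indicator {U<..} y))
          + ennreal (K / U\<^sup>2))
     \<and>
     (\<exists>K\<ge>0. \<forall>(l::int) L. L = of_int l / 2 powi m \<and> L < min 0 (\<mu> - 1) \<longrightarrow>
        T_minus m \<alpha> f P l \<le>
            ennreal (C\<^sub>m * exp (\<alpha> * \<mu>))
              * ((Linf_norm {..L} (damp_payoff \<alpha> P) + ennreal (eps_V m \<alpha> P / \<bar>L\<bar>))
                  / ennreal ((a + \<alpha>) powr \<gamma>\<^sub>m))
              * ennreal (upper_Gamma \<gamma>\<^sub>m ((a + \<alpha>) * \<bar>L - \<mu>\<bar>))
          + ennreal (eps_D m \<alpha> f) * L1_norm {..L} (damp_payoff \<alpha> P) * ennreal (1 / \<bar>L - \<mu>\<bar>)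
          + ennreal (eps_D m \<alpha> f * eps_V m \<alpha> P * log_term_minus \<mu> L)
          + ennreal (2 powi (1 - m))
              * (\<Sum>\<^sub>\<infinity>y\<in>local_maxima (G_minus m f P \<alpha> \<mu> a \<gamma>\<^sub>m C\<^sub>m) ({..<0} \<inter> {..<\<mu> - 1}).
                   ennreal (G_minus m f P \<alpha> \<mu> a \<gamma>\<^sub>m C\<^sub>m y * indicator {..<L} y))
          + ennreal (K / L\<^sup>2))"
proof -
  obtain a' b' \<gamma>\<^sub>p' \<gamma>\<^sub>m' where P: "assumption_A (damp_payoff \<alpha> P) a' b' \<gamma>\<^sub>p' \<gamma>\<^sub>m'"
    using assms(4) by blast
  obtain K\<^sub>p where K\<^sub>p: "K\<^sub>p \<ge> 0" "\<And>u. grid m u > max 0 (1 + \<mu>) \<Longrightarrow> T_plus m \<alpha> f P u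
      \<le> ennreal (eps_D m \<alpha> f * eps_V m \<alpha> P * log_term_plus \<mu> (grid m u)) + ennreal (K\<^sub>p / (grid m u)\<^sup>2)"
    using T_plus_bound[OF assms(2,3) P assms(7,9)] by blast
  obtain K\<^sub>m where K\<^sub>m: "K\<^sub>m \<ge> 0" "\<And>l. grid m l < min 0 (\<mu> - 1) \<Longrightarrow> T_minus m \<alpha> f P l
      \<le> ennreal (eps_D m \<alpha> f * eps_V m \<alpha> P * log_term_minus \<mu> (grid m l)) + ennreal (K\<^sub>m / (grid m l)\<^sup>2)"
    using T_minus_bound[OF assms(2,3) P assms(8,9)] by blast
  \<comment> \<open>\<open>K\<^sub>p\<close> and \<open>K\<^sub>m\<close> are fixed before
    \<open>u\<close> and \<open>l\<close>, which makes the remainders uniform;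
    \<open>grid_eq\<close> and substitution put U and L in grid form.\<close>
  show ?thesis
    unfolding grid_eq
    by (intro conjI exI[of _ K\<^sub>p] exI[of _ K\<^sub>m] K\<^sub>p(1) K\<^sub>m(1) allI impI ennreal_sum_le_extend; elim conjE; hypsubst)
      (rule K\<^sub>p(2) K\<^sub>m(2), assumption)+
qed

end
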